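(* Consider the kernel least squares problem with a bounded kernel and bounded outputs, that is, suppose there exist $\kappa,M>0$ such that $K(\mathbf x,\mathbf x')\le\kappa$ and $|y|\le M$ almost surely. Then the excess risk of the minimum norm interpolating kernel least squares solution can be bounded as $$\mathbb E_S\Big[I[f_{S_i}^\dagger]-\inf_{f\in\mathcal H}I[f]\Big]\le C_1\beta_1+C_2\beta_2,$$ where $$\beta_1=\mathbb E_S\Big[\|\mathbf K^{1/2}\|_{op}\,\|\mathbf K^\dagger\|_{op}\,\mathrm{cond}(\mathbf K)\,\|\mathbf y\|\Big],\qquad \beta_2=\mathbb E_S\Big[\|\mathbf K^{1/2}\|_{op}^2\,\|\mathbf K^\dagger\|_{op}^2\,(\mathrm{cond}(\mathbf K))^2\,\|\mathbf y\|^2\Big],$$ and $C_1,C_2$ are absolute constants that do not depend on either $d$ or $n$.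
   Context: $S=(\mathbf x_j,y_j)_{j=1}^n$ is a training set of $n$ samples drawn i.i.d. from a probability distribution $\mu$ on $\mathbb R^d\times\mathbb R$; $S_i$ is $S$ with the $i$-th example removed, $i\in\{1,\dots,n\}$. $\mathcal H$ is the reproducing kernel Hilbert space of a positive definite kernel $K:\mathbb R^d\times\mathbb R^d\to\mathbb R$. For a function $f$, $I[f]=\mathbb E_{(\mathbf x,y)\sim\mu}(y-f(\mathbf x))^2$ is the expected risk under the square loss. $\mathbf y=(y_1,\dots,y_n)^\top$, $\mathbf K\in\mathbb R^{n\times n}$ is the kernel matrix $\mathbf K_{jk}=K(\mathbf x_j,\mathbf x_k)$ on the full sample $S$, $\dagger$ is the Moore–Penrose pseudoinverse, $\|\cdot\|_{op}$ the operator norm, $\|\cdot\|$ the Euclidean norm, and $\mathrm{cond}(\mathbf K)$ the condition number of $\mathbf K$. $f_{S_i}^\dagger$ is the minimum-$\mathcal H$-norm interpolating solution on $S_i$, i.e. the minimum-norm element among the $f\in\mathcal H$ with $f(\mathbf x_j)=y_j$ for all $j\ne i$.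
   Formalization: Assumes that almost surely some f in H interpolates all of S, not only S_i, and that K(x,x') ≤ κ also for x = x' on a set of full measure; without these the bound can fail. C_1, C_2 may depend on κ and M, and cond(K) is ‖K‖‖K†‖. *)

theory Defs
  imports
    "HOL-Probability.Probability"
    "Jordan_Normal_Form.Matrix"
begin

text \<open>
  The dimension \<open>d\<close> is a term variable, so that constants can be chosen before it:
  a point of \<open>\<real>\<^sup>d\<close> is a function \<open>nat \<Rightarrow> real\<close> that is extensional on \<open>{..<d}\<close>.
\<close>

definition Rd :: "nat \<Rightarrow> (nat \<Rightarrow> real) measure" where
  "Rd d = (\<Pi>\<^sub>M k\<in>{..<d}. (borel :: real measure))"

definition pd_kernel :: "'x set \<Rightarrow> ('x \<Rightarrow> 'x \<Rightarrow> real) \<Rightarrow> bool" where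
  "pd_kernel X K \<longleftrightarrow>
     (\<forall>x\<in>X. \<forall>x'\<in>X. K x x' = K x' x) \<and>
     (\<forall>F c. finite F \<and> F \<subseteq> X \<longrightarrow> 0 \<le> (\<Sum>x\<in>F. \<Sum>x'\<in>F. c x * c x' * K x x'))"

definition kernel_section :: "'x set \<Rightarrow> ('x \<Rightarrow> 'x \<Rightarrow> real) \<Rightarrow> 'x \<Rightarrow> 'x \<Rightarrow> real" where
  "kernel_section X K x = (\<lambda>t. if t \<in> X then K x t else 0)"

definition hnorm :: "(('x \<Rightarrow> real) \<Rightarrow> ('x \<Rightarrow> real) \<Rightarrow> real) \<Rightarrow> ('x \<Rightarrow> real) \<Rightarrow> real" where
  "hnorm ip f = sqrt (ip f f)"

text \<open>
  \<open>H\<close> with inner product \<open>ip\<close> is the Hilbert space of real functions on \<open>X\<close> with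
  reproducing kernel \<open>K\<close>. Functions on \<open>X\<close> are represented by functions on the whole type
  that vanish outside \<open>X\<close>, so that equality in \<open>H\<close> is equality of functions on \<open>X\<close>.
\<close>

locale rkhs =
  fixes X :: "'x set"
    and K :: "'x \<Rightarrow> 'x \<Rightarrow> real"
    and H :: "('x \<Rightarrow> real) set"
    and ip :: "('x \<Rightarrow> real) \<Rightarrow> ('x \<Rightarrow> real) \<Rightarrow> real"
  assumes vanish_outside: "f \<in> H \<Longrightarrow> x \<notin> X \<Longrightarrow> f x = 0"
    and zero_mem: "(\<lambda>_. 0) \<in> H"
    and add_mem: "f \<in> H \<Longrightarrow> g \<in> H \<Longrightarrow> (\<lambda>x. f x + g x) \<in> H"
    and scale_mem: "f \<in> H \<Longrightarrow> (\<lambda>x. a * f x) \<in> H"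
    and ip_commute: "f \<in> H \<Longrightarrow> g \<in> H \<Longrightarrow> ip f g = ip g f"
    and ip_add_left: "f \<in> H \<Longrightarrow> g \<in> H \<Longrightarrow> h \<in> H \<Longrightarrow> ip (\<lambda>x. f x + g x) h = ip f h + ip g h"
    and ip_scale_left: "f \<in> H \<Longrightarrow> g \<in> H \<Longrightarrow> ip (\<lambda>x. a * f x) g = a * ip f g"
    and ip_nonneg: "f \<in> H \<Longrightarrow> 0 \<le> ip f f"
    and ip_definite: "f \<in> H \<Longrightarrow> ip f f = 0 \<Longrightarrow> f = (\<lambda>_. 0)"
    and complete: "(\<And>m. s m \<in> H) \<Longrightarrow>
        (\<And>e. 0 < e \<Longrightarrow> \<exists>N. \<forall>m\<ge>N. \<forall>k\<ge>N. hnorm ip (\<lambda>x. s m x - s k x) < e) \<Longrightarrow>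
        \<exists>f\<in>H. (\<lambda>m. hnorm ip (\<lambda>x. s m x - f x)) \<longlonglongrightarrow> 0"
    and section_mem: "x \<in> X \<Longrightarrow> kernel_section X K x \<in> H"
    and reproducing: "f \<in> H \<Longrightarrow> x \<in> X \<Longrightarrow> ip f (kernel_section X K x) = f x"

text \<open>
  The risk takes values in \<open>[0, \<infinity>]\<close>; a Bochner integral would be \<open>0\<close> for a
  non-integrable loss.
\<close>

definition risk :: "('x \<times> real) measure \<Rightarrow> ('x \<Rightarrow> real) \<Rightarrow> ennreal" where
  "risk \<mu> f = (\<integral>\<^sup>+ z. ennreal ((snd z - f (fst z))\<^sup>2) \<partial>\<mu>)"

definition interpolants ::
    "('x \<Rightarrow> real) set \<Rightarrow> nat set \<Rightarrow> (nat \<Rightarrow> 'x \<times> real) \<Rightarrow> ('x \<Rightarrow> real) set" where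
  "interpolants H J S = {f \<in> H. \<forall>j\<in>J. f (fst (S j)) = snd (S j)}"

definition min_norm_interpolant ::
    "('x \<Rightarrow> real) set \<Rightarrow> (('x \<Rightarrow> real) \<Rightarrow> ('x \<Rightarrow> real) \<Rightarrow> real) \<Rightarrow>
     nat set \<Rightarrow> (nat \<Rightarrow> 'x \<times> real) \<Rightarrow> 'x \<Rightarrow> real" where
  "min_norm_interpolant H ip J S = arg_min (hnorm ip) (\<lambda>f. f \<in> interpolants H J S)"

definition vnorm :: "real vec \<Rightarrow> real" where
  "vnorm v = sqrt (scalar_prod v v)"

definition op_norm :: "real mat \<Rightarrow> real" where
  "op_norm A = (SUP v \<in> {v \<in> carrier_vec (dim_col A). vnorm v \<le> 1}. vnorm (A *\<^sub>v v))"

text \<open>The four Penrose equations determine the pseudoinverse uniquely.\<close>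

definition pinv :: "real mat \<Rightarrow> real mat" where
  "pinv A = (THE B. B \<in> carrier_mat (dim_col A) (dim_row A) \<and>
     A * B * A = A \<and> B * A * B = B \<and>
     transpose_mat (A * B) = A * B \<and> transpose_mat (B * A) = B * A)"

definition psd_mat :: "real mat \<Rightarrow> bool" where
  "psd_mat A \<longleftrightarrow> square_mat A \<and> transpose_mat A = A \<and>
     (\<forall>v \<in> carrier_vec (dim_row A). 0 \<le> scalar_prod v (A *\<^sub>v v))"

definition psd_sqrt :: "real mat \<Rightarrow> real mat" where
  "psd_sqrt A = (THE B. B \<in> carrier_mat (dim_row A) (dim_row A) \<and> psd_mat B \<and> B * B = A)"

text \<open>
  Spectral condition number, for possibly singular matrices: largest over smallest nonzero
  singular value.
\<close>

definition cond_num :: "real mat \<Rightarrow> real" where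
  "cond_num A = op_norm A * op_norm (pinv A)"

definition kernel_mat ::
    "('x \<Rightarrow> 'x \<Rightarrow> real) \<Rightarrow> nat \<Rightarrow> (nat \<Rightarrow> 'x \<times> real) \<Rightarrow> real mat" where
  "kernel_mat K n S = mat n n (\<lambda>(j, k). K (fst (S j)) (fst (S k)))"

definition label_vec :: "nat \<Rightarrow> (nat \<Rightarrow> 'x \<times> real) \<Rightarrow> real vec" where
  "label_vec n S = vec n (\<lambda>j. snd (S j))"

definition sample_measure :: "('x \<times> real) measure \<Rightarrow> nat \<Rightarrow> (nat \<Rightarrow> 'x \<times> real) measure" where
  "sample_measure \<mu> n = (\<Pi>\<^sub>M j\<in>{..<n}. \<mu>)"

definition beta1 :: "('x \<times> real) measure \<Rightarrow> ('x \<Rightarrow> 'x \<Rightarrow> real) \<Rightarrow> nat \<Rightarrow> ennreal" where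
  "beta1 \<mu> K n = (\<integral>\<^sup>+ S. ennreal
     (op_norm (psd_sqrt (kernel_mat K n S)) * op_norm (pinv (kernel_mat K n S)) *
      cond_num (kernel_mat K n S) * vnorm (label_vec n S)) \<partial>sample_measure \<mu> n)"

definition beta2 :: "('x \<times> real) measure \<Rightarrow> ('x \<Rightarrow> 'x \<Rightarrow> real) \<Rightarrow> nat \<Rightarrow> ennreal" where
  "beta2 \<mu> K n = (\<integral>\<^sup>+ S. ennreal
     ((op_norm (psd_sqrt (kernel_mat K n S)))\<^sup>2 * (op_norm (pinv (kernel_mat K n S)))\<^sup>2 *
      (cond_num (kernel_mat K n S))\<^sup>2 * (vnorm (label_vec n S))\<^sup>2) \<partial>sample_measure \<mu> n)"

text \<open>
  \<open>i\<close> is the removed example. The subtraction is in \<open>ennreal\<close>; it is the true difference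
  whenever the interpolant lies in \<open>H\<close> and the infimum is finite, e.g. for bounded outputs.
\<close>

definition expected_excess_risk ::
    "('x \<times> real) measure \<Rightarrow> ('x \<Rightarrow> real) set \<Rightarrow>
     (('x \<Rightarrow> real) \<Rightarrow> ('x \<Rightarrow> real) \<Rightarrow> real) \<Rightarrow> nat \<Rightarrow> nat \<Rightarrow> ennreal" where
  "expected_excess_risk \<mu> H ip n i =
     (\<integral>\<^sup>+ S. (risk \<mu> (min_norm_interpolant H ip ({..<n} - {i}) S) - (INF f\<in>H. risk \<mu> f))
        \<partial>sample_measure \<mu> n)"

text \<open>
  The kernel bound is required for all pairs of points, equal ones included, from a set of full
  measure. A bound for almost all pairs of independent points would say nothing about
  \<open>K x x\<close> when the distribution has no atoms.
\<close>

definition ae_bounded_kernel ::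
    "('x \<times> real) measure \<Rightarrow> ('x \<Rightarrow> 'x \<Rightarrow> real) \<Rightarrow> real \<Rightarrow> bool" where
  "ae_bounded_kernel \<mu> K \<kappa> \<longleftrightarrow>
     (\<exists>A. (AE z in \<mu>. fst z \<in> A) \<and> (\<forall>x\<in>A. \<forall>x'\<in>A. K x x' \<le> \<kappa>))"

end

theory Submission
  imports Defs
begin

text \<open>
  The constants \<open>C1 = 0\<close> and \<open>C2 = \<kappa>\<close> suffice. The excess risk is at most the risk, and since the interpolant
  \<open>g\<close> on the reduced sample is independent of the removed example, its expected risk is the expectation
  of the leave-one-out error \<open>(y\<^sub>i - g(x\<^sub>i))\<^sup>2\<close>. If \<open>h = \<Sum>\<^sub>j p\<^sub>j K(x\<^sub>j, \<cdot>)\<close> with \<open>p = K\<^sup>\<dagger> y\<close> is the interpolant on the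
  full sample, then \<open>g\<close> is orthogonal to \<open>h - g\<close>, so the error is at most
  \<open>\<kappa> \<parallel>h - g\<parallel>\<^sup>2 \<le> \<kappa> \<parallel>h\<parallel>\<^sup>2 = \<kappa> y \<cdot> K\<^sup>\<dagger> y \<le> \<kappa> \<parallel>K\<^sup>\<dagger>\<parallel> \<parallel>y\<parallel>\<^sup>2\<close>. Finally \<open>\<parallel>K\<^sup>\<dagger>\<parallel>\<close> is at most the product
  in \<open>beta2\<close>, because \<open>cond(K) \<ge> 1\<close> unless \<open>K = 0\<close>, and \<open>\<parallel>K\<parallel> \<le> \<parallel>K\<^bsup>1/2\<^esup>\<parallel>\<^sup>2\<close>. Fubini's theorem requires \<open>g\<close> to be measurable in the
  sample, which is read off a recursion that interpolates one point after the other.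
\<close>

unbundle no vec_syntax

section \<open>Operator norm\<close>

lemma vnorm_nonneg: "0 \<le> vnorm v"
  by (simp add: vnorm_def scalar_prod_def sum_nonneg)

lemma scalar_prod_self_nonneg: "0 \<le> scalar_prod v (v :: real vec)"
  by (simp add: scalar_prod_def sum_nonneg)

lemma vnorm_squared: "(vnorm v)\<^sup>2 = scalar_prod v v"
  by (simp add: vnorm_def scalar_prod_self_nonneg)

lemma scalar_prod_self_eq_0:
  assumes "v \<in> carrier_vec n" "scalar_prod v (v :: real vec) = 0"
  shows "v = 0\<^sub>v n"
proof (rule eq_vecI)
  fix i assume "i < dim_vec (0\<^sub>v n :: real vec)"
  moreover have "\<forall>i\<in>{0..<n}. v $ i * v $ i = 0"
    using assms by (subst sum_nonneg_eq_0_iff[symmetric]) (auto simp: scalar_prod_def)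
  ultimately show "v $ i = (0\<^sub>v n) $ i" by auto
qed (use assms in auto)

lemma scalar_prod_Cauchy_Schwarz:
  assumes "u \<in> carrier_vec n" "v \<in> carrier_vec n"
  shows "\<bar>scalar_prod u v\<bar> \<le> vnorm u * vnorm v"
proof -
  have "(scalar_prod u v)\<^sup>2 \<le> scalar_prod u u * scalar_prod v v"
    using Cauchy_Schwarz_ineq_sum[of "\<lambda>i. u $ i" "\<lambda>i. v $ i" "{0..<n}"] assms
    by (simp add: scalar_prod_def power2_eq_square)
  then have "sqrt ((scalar_prod u v)\<^sup>2) \<le> sqrt (scalar_prod u u * scalar_prod v v)"
    by (rule real_sqrt_le_mono)
  then show ?thesis by (simp add: vnorm_def real_sqrt_mult)
qed

lemma vnorm_smult: "vnorm (c \<cdot>\<^sub>v v) = \<bar>c\<bar> * vnorm v"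
  by (simp add: vnorm_def real_sqrt_mult mult.assoc[symmetric])

text \<open>A real supremum is informative only over a bounded set. By Cauchy-Schwarz each entry of
  \<open>A *\<^sub>v v\<close> is at most the norm of its row in absolute value, so the Frobenius
  norm is an upper bound.\<close>

lemma bdd_above_op_norm:
  "bdd_above ((\<lambda>v. vnorm (A *\<^sub>v v)) ` {v \<in> carrier_vec (dim_col A). vnorm v \<le> 1})"
proof (rule bdd_aboveI2)
  fix v assume v: "v \<in> {v \<in> carrier_vec (dim_col A). vnorm v \<le> 1}"
  have "(vnorm (A *\<^sub>v v))\<^sup>2 = (\<Sum>i\<in>{0..<dim_row A}. (scalar_prod (row A i) v)\<^sup>2)"
    unfolding vnorm_squared by (simp add: scalar_prod_def power2_eq_square)
  also have "\<dots> \<le> (\<Sum>i\<in>{0..<dim_row A}. (vnorm (row A i))\<^sup>2)"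
  proof (rule sum_mono)
    fix i assume "i \<in> {0..<dim_row A}"
    have "\<bar>scalar_prod (row A i) v\<bar> \<le> vnorm (row A i) * vnorm v"
      using v by (intro scalar_prod_Cauchy_Schwarz[of _ "dim_col A"]) auto
    also have "\<dots> \<le> vnorm (row A i)"
      using v vnorm_nonneg by (simp add: mult_left_le)
    finally show "(scalar_prod (row A i) v)\<^sup>2 \<le> (vnorm (row A i))\<^sup>2"
      using abs_le_square_iff[of "scalar_prod (row A i) v" "vnorm (row A i)"]
        vnorm_nonneg[of "row A i"] by simp
  qed
  finally show "vnorm (A *\<^sub>v v) \<le> sqrt (\<Sum>i\<in>{0..<dim_row A}. (vnorm (row A i))\<^sup>2)"
    by (rule real_le_rsqrt)
qed

lemma op_norm_nonneg: "0 \<le> op_norm A"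
proof -
  have "vnorm (A *\<^sub>v 0\<^sub>v (dim_col A)) \<le> op_norm A"
    unfolding op_norm_def
    by (rule cSUP_upper[OF _ bdd_above_op_norm]) (simp add: vnorm_def)
  then show ?thesis using vnorm_nonneg order_trans by blast
qed

lemma vnorm_mult_mat_vec_le:
  assumes "A \<in> carrier_mat m n" "v \<in> carrier_vec n"
  shows "vnorm (A *\<^sub>v v) \<le> op_norm A * vnorm v"
proof (cases "vnorm v = 0")
  case True
  then have "v = 0\<^sub>v n"
    using scalar_prod_self_eq_0[OF assms(2)] vnorm_squared[of v] by simp
  then have "A *\<^sub>v v = 0\<^sub>v m" using assms by auto
  then show ?thesis using True by (simp add: vnorm_def)
next
  case False
  then have pos: "0 < vnorm v" using vnorm_nonneg[of v] by simp
  have "vnorm (A *\<^sub>v ((1 / vnorm v) \<cdot>\<^sub>v v)) \<le> op_norm A"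
    unfolding op_norm_def
    by (rule cSUP_upper[OF _ bdd_above_op_norm]) (use assms pos in \<open>auto simp: vnorm_smult\<close>)
  then have "vnorm (A *\<^sub>v v) / vnorm v \<le> op_norm A"
    using pos assms by (simp add: mult_mat_vec[OF assms] vnorm_smult)
  then show ?thesis using pos by (simp add: divide_le_eq)
qed

lemma op_norm_mult_le:
  assumes "A \<in> carrier_mat m n" "B \<in> carrier_mat n k"
  shows "op_norm (A * B) \<le> op_norm A * op_norm B"
proof -
  have "vnorm (A * B *\<^sub>v v) \<le> op_norm A * op_norm B"
    if v: "v \<in> carrier_vec (dim_col (A * B))" "vnorm v \<le> 1" for v
  proof -
    have v': "v \<in> carrier_vec k" using v assms by simp
    have "vnorm (A * B *\<^sub>v v) = vnorm (A *\<^sub>v (B *\<^sub>v v))"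
      using assoc_mult_mat_vec[OF assms v'] by simp
    also have "\<dots> \<le> op_norm A * vnorm (B *\<^sub>v v)"
      by (rule vnorm_mult_mat_vec_le[OF assms(1)]) (use assms v' in auto)
    also have "\<dots> \<le> op_norm A * (op_norm B * vnorm v)"
      using vnorm_mult_mat_vec_le[OF assms(2) v'] op_norm_nonneg by (intro mult_left_mono)
    also have "\<dots> \<le> op_norm A * op_norm B"
      using v(2) op_norm_nonneg vnorm_nonneg
      by (intro mult_left_mono mult_left_le) auto
    finally show ?thesis .
  qed
  moreover have "0\<^sub>v (dim_col (A * B)) \<in> {v \<in> carrier_vec (dim_col (A * B)). vnorm v \<le> 1}"
    by (simp add: vnorm_def)
  then have "{v \<in> carrier_vec (dim_col (A * B)). vnorm v \<le> 1} \<noteq> {}" by blast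
  ultimately show ?thesis
    unfolding op_norm_def[of "A * B"] by (intro cSUP_least) auto
qed

text \<open>Unit vectors read off the columns, which all have norm 0.\<close>

lemma op_norm_eq_0:
  assumes "A \<in> carrier_mat m n" "op_norm A = 0"
  shows "A = 0\<^sub>m m n"
proof (rule eq_matI)
  fix i j assume ij: "i < dim_row (0\<^sub>m m n :: real mat)" "j < dim_col (0\<^sub>m m n :: real mat)"
  have "vnorm (A *\<^sub>v unit_vec n j) = 0"
    using vnorm_mult_mat_vec_le[OF assms(1), of "unit_vec n j"] assms(2)
      vnorm_nonneg[of "A *\<^sub>v unit_vec n j"] by simp
  then have "A *\<^sub>v unit_vec n j = 0\<^sub>v m"
    using scalar_prod_self_eq_0[of "A *\<^sub>v unit_vec n j" m] vnorm_squared[of "A *\<^sub>v unit_vec n j"] assms(1)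
    by auto
  then have "(A *\<^sub>v unit_vec n j) $ i = 0" using ij by simp
  then show "A $$ (i, j) = 0\<^sub>m m n $$ (i, j)"
    using ij assms(1) by simp
qed (use assms in auto)

section \<open>Spectral resolution of positive semidefinite matrices\<close>

text \<open>With \<open>w = A *\<^sub>v v\<close>, the quadratic form at
  \<open>v + t \<cdot>\<^sub>v w\<close> is \<open>2 * t * b + t\<^sup>2 * c\<close>, where
  \<open>b\<close> is the squared norm of \<open>w\<close>. It is nonnegative for every
  \<open>t\<close>, so the linear coefficient must vanish.\<close>

lemma psd_mat_quadratic_zero:
  assumes A: "A \<in> carrier_mat n n" "psd_mat A" and v: "v \<in> carrier_vec n"
    and zero: "scalar_prod v (A *\<^sub>v v) = 0"
  shows "A *\<^sub>v v = 0\<^sub>v n"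
proof -
  define w where "w = A *\<^sub>v v"
  define c where "c = scalar_prod w (A *\<^sub>v w)"
  define b where "b = scalar_prod w w"
  have w: "w \<in> carrier_vec n" using A v by (simp add: w_def)
  have Aw: "A *\<^sub>v w \<in> carrier_vec n" using A w by auto
  have sym: "scalar_prod v (A *\<^sub>v w) = scalar_prod w w"
    using transpose_vec_mult_scalar[OF A(1) w v] A(2) by (simp add: psd_mat_def w_def)
  have "0 \<le> 2 * t * b + t\<^sup>2 * c" for t
  proof -
    have "0 \<le> scalar_prod (v + t \<cdot>\<^sub>v w) (A *\<^sub>v (v + t \<cdot>\<^sub>v w))"
      using A v w by (simp add: psd_mat_def)
    also have "A *\<^sub>v (v + t \<cdot>\<^sub>v w) = w + t \<cdot>\<^sub>v (A *\<^sub>v w)"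
      using A v w by (simp add: mult_add_distrib_mat_vec[OF A(1)] mult_mat_vec[OF A(1)] w_def)
    also have "scalar_prod (v + t \<cdot>\<^sub>v w) (w + t \<cdot>\<^sub>v (A *\<^sub>v w)) = 2 * t * b + t\<^sup>2 * c"
      using v w Aw zero
      by (simp add: add_scalar_prod_distrib[of _ n] scalar_prod_add_distrib[of _ n] sym b_def c_def
          power2_eq_square algebra_simps flip: w_def)
    finally show ?thesis .
  qed
  \<comment> \<open>The minimizing \<open>t\<close> would be \<open>- b / c\<close>; the added 1
    keeps the denominator positive when \<open>c = 0\<close>, and the value is still strictly
    negative unless \<open>b = 0\<close>.\<close>
  from this[of "- b / (c + 1)"] have "0 \<le> 2 * (- b / (c + 1)) * b + (- b / (c + 1))\<^sup>2 * c" .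
  moreover have c: "0 \<le> c" using A w by (simp add: psd_mat_def c_def)
  moreover have "2 * (- b / s) * b + (- b / s)\<^sup>2 * (s - 1) = - (b\<^sup>2 * (s + 1)) / s\<^sup>2"
    if "s \<noteq> 0" for s
    using that by (simp add: field_simps power2_eq_square)
  from this[of "c + 1"] have
    "2 * (- b / (c + 1)) * b + (- b / (c + 1))\<^sup>2 * c = - (b\<^sup>2 * (c + 2)) / (c + 1)\<^sup>2"
    using c by (simp add: add.commute)
  ultimately have "0 \<le> - (b\<^sup>2 * (c + 2)) / (c + 1)\<^sup>2" by (simp only:)
  moreover have "0 < (c + 1)\<^sup>2" using c by simp
  ultimately have "0 \<le> - (b\<^sup>2 * (c + 2))" by (meson not_le zero_le_divide_iff)
  then have "b\<^sup>2 * (c + 2) \<le> 0" by simp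
  then have "b = 0" using c
    by (metis add_nonneg_pos mult_le_0_iff not_le power2_less_eq_zero_iff zero_less_numeral)
  then show ?thesis using scalar_prod_self_eq_0[OF w] by (simp add: b_def w_def)
qed

text \<open>The eigenvalue is the maximum \<open>l\<close> of the quadratic form on the unit sphere.
  Then \<open>l\<close> times the identity minus \<open>A\<close> is positive semidefinite, and its
  form vanishes at a maximizer, which therefore lies in its kernel.\<close>

lemma psd_mat_eigenvector:
  assumes A: "A \<in> carrier_mat n n" "psd_mat A" "A \<noteq> 0\<^sub>m n n"
  obtains l v where "0 < l" "v \<in> carrier_vec n" "scalar_prod v v = 1" "A *\<^sub>v v = l \<cdot>\<^sub>v v"
proof -
  \<comment> \<open>Unit vectors are encoded as functions that vanish from \<open>n\<close> on and
    have coordinates in [-1, 1]. They form a closed part of the box \<open>P\<close>, which is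
    compact by Tychonoff's theorem.\<close>
  define P :: "(nat \<Rightarrow> real) set" where "P = Pi\<^sub>E UNIV (\<lambda>i. if i < n then {-1..1} else {0})"
  define S where "S = {f \<in> P. (\<Sum>i<n. f i * f i) = 1}"
  define q where "q = (\<lambda>f :: nat \<Rightarrow> real. \<Sum>i<n. \<Sum>j<n. f i * (A $$ (i, j) * f j))"
  have q_vec: "q f = scalar_prod (vec n f) (A *\<^sub>v vec n f)" for f
    using A(1) by (auto simp: q_def scalar_prod_def sum_distrib_left lessThan_atLeast0
        intro!: sum.cong)
  have "compactin (product_topology (\<lambda>i. euclidean) UNIV) P"
    unfolding P_def compactin_PiE by (auto simp: compactin_euclidean_iff)
  then have "compact P"
    by (simp add: euclidean_product_topology flip: compactin_euclidean_iff)
  moreover have "closed {f :: nat \<Rightarrow> real. (\<Sum>i<n. f i * f i) = 1}"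
    by (intro closed_Collect_eq continuous_intros continuous_on_product_coordinates)
  ultimately have "compact S"
    unfolding S_def using compact_Int_closed by (auto simp: Collect_conj_eq)
  have vec_S: "vec n f \<in> carrier_vec n \<and> scalar_prod (vec n f) (vec n f) = 1" if "f \<in> S" for f
    using that by (simp add: S_def scalar_prod_def lessThan_atLeast0)
  \<comment> \<open>A vector outside the kernel of \<open>A\<close> has a nonzero form value by
    \<open>psd_mat_quadratic_zero\<close>; this will make the maximum positive.\<close>
  obtain w where w: "w \<in> carrier_vec n" "A *\<^sub>v w \<noteq> 0\<^sub>v n"
  proof -
    obtain i j where "i < n" "j < n" "A $$ (i, j) \<noteq> 0"
      using A(1,3) by (metis carrier_matD eq_matI index_zero_mat)
    then have "(A *\<^sub>v unit_vec n j) $ i \<noteq> 0" using A(1) by simp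
    then show ?thesis
      using that[of "unit_vec n j"] \<open>i < n\<close> index_zero_vec(1)[of i n] by (metis unit_vec_carrier)
  qed
  \<comment> \<open>By homogeneity, bounds on the sphere carry over to all nonzero vectors.\<close>
  have normalize: "\<exists>f\<in>S. scalar_prod u (A *\<^sub>v u) = scalar_prod u u * q f"
    if u: "u \<in> carrier_vec n" "u \<noteq> 0\<^sub>v n" for u
  proof -
    define f where "f = (\<lambda>i. if i < n then u $ i / vnorm u else 0)"
    have pos: "0 < scalar_prod u u"
      using scalar_prod_self_eq_0[OF u(1)] u(2) scalar_prod_self_nonneg[of u] by force
    have vu: "u = vnorm u \<cdot>\<^sub>v vec n f"
      using pos u(1) by (intro eq_vecI) (auto simp: f_def vnorm_def)
    have sumf: "(\<Sum>i<n. f i * f i) = 1"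
    proof -
      have "(\<Sum>i<n. f i * f i) = (\<Sum>i<n. (u $ i * u $ i) / scalar_prod u u)"
        using pos by (intro sum.cong) (auto simp: f_def vnorm_def)
      also have "\<dots> = 1"
        using pos u(1) by (simp add: sum_divide_distrib[symmetric] scalar_prod_def lessThan_atLeast0)
      finally show ?thesis .
    qed
    have "\<bar>f i\<bar> \<le> 1" if "i < n" for i
    proof -
      have "f i * f i \<le> (\<Sum>i<n. f i * f i)"
        using that by (intro member_le_sum) auto
      then show ?thesis using sumf abs_le_square_iff[of "f i" 1] by (simp add: power2_eq_square)
    qed
    then have "f i \<in> (if i < n then {-1..1} else {0})" for i
      by (cases "i < n") (auto simp: abs_le_iff minus_le_iff, simp add: f_def)
    then have "f \<in> S"
      unfolding S_def P_def using sumf by (simp add: PiE_UNIV_domain)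
    moreover have "scalar_prod u (A *\<^sub>v u) = scalar_prod u u * q f"
      unfolding q_vec
      by (subst (1 2) vu) (use A(1) in \<open>simp add: mult_mat_vec[OF A(1)] vnorm_squared[symmetric] power2_eq_square\<close>)
    ultimately show ?thesis by blast
  qed
  have "w \<noteq> 0\<^sub>v n" using w A(1) by auto
  then obtain f0 where f0: "f0 \<in> S" "scalar_prod w (A *\<^sub>v w) = scalar_prod w w * q f0"
    using normalize w(1) by blast
  have "continuous_on UNIV q"
    unfolding q_def by (intro continuous_intros continuous_on_product_coordinates)
  then have "continuous_on S q" by (rule continuous_on_subset) simp
  then obtain f where f: "f \<in> S" "\<And>g. g \<in> S \<Longrightarrow> q g \<le> q f"
    using continuous_attains_sup[OF \<open>compact S\<close>] f0(1) by blast
  define v where "v = vec n f"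
  define l where "l = q f"
  have v: "v \<in> carrier_vec n" "scalar_prod v v = 1" using vec_S[OF f(1)] by (auto simp: v_def)
  define B where "B = mat n n (\<lambda>(i, j). (if i = j then l else 0) - A $$ (i, j))"
  have B: "B \<in> carrier_mat n n" by (simp add: B_def)
  have Bv: "B *\<^sub>v u = l \<cdot>\<^sub>v u - A *\<^sub>v u" if "u \<in> carrier_vec n" for u
    using that A(1)
    by (intro eq_vecI)
      (auto simp: B_def scalar_prod_def left_diff_distrib sum_subtractf if_distrib[of "\<lambda>x. x * _"]
        cong: if_cong)
  have uBu: "scalar_prod u (B *\<^sub>v u) = l * scalar_prod u u - scalar_prod u (A *\<^sub>v u)"
    if "u \<in> carrier_vec n" for u
    using that A(1) by (simp add: Bv scalar_prod_minus_distrib[of _ n])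
  have "0 \<le> scalar_prod u (B *\<^sub>v u)" if u: "u \<in> carrier_vec n" for u
  proof (cases "u = 0\<^sub>v n")
    case True
    then show ?thesis using B by simp
  next
    case False
    then obtain g where "g \<in> S" "scalar_prod u (A *\<^sub>v u) = scalar_prod u u * q g"
      using normalize u by blast
    then show ?thesis
      using uBu[OF u] mult_right_mono[OF f(2) scalar_prod_self_nonneg[of u]]
      by (simp add: l_def mult.commute)
  qed
  moreover have "transpose_mat B = B"
  proof (rule eq_matI)
    fix i j assume "i < dim_row B" "j < dim_col B"
    then have ij: "i < n" "j < n" by (auto simp: B_def)
    have "transpose_mat A $$ (i, j) = A $$ (i, j)" using A(2) by (simp add: psd_mat_def)
    then show "transpose_mat B $$ (i, j) = B $$ (i, j)"
      using ij A(1) by (simp add: B_def)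
  qed (auto simp: B_def)
  ultimately have "psd_mat B" using B by (simp add: psd_mat_def square_mat.simps)
  moreover have "scalar_prod v (B *\<^sub>v v) = 0"
    using uBu v by (simp add: l_def q_vec v_def)
  ultimately have "B *\<^sub>v v = 0\<^sub>v n" by (intro psd_mat_quadratic_zero[OF B _ v(1)])
  have eig: "A *\<^sub>v v = l \<cdot>\<^sub>v v"
  proof (rule eq_vecI)
    fix i assume "i < dim_vec (l \<cdot>\<^sub>v v)"
    then have i: "i < n" using v(1) by simp
    then have "(l \<cdot>\<^sub>v v - A *\<^sub>v v) $ i = 0"
      using \<open>B *\<^sub>v v = 0\<^sub>v n\<close> Bv[OF v(1)] by simp
    then show "(A *\<^sub>v v) $ i = (l \<cdot>\<^sub>v v) $ i"
      using i A(1) v(1) by simp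
  qed (use A(1) v(1) in auto)
  have "scalar_prod w (A *\<^sub>v w) \<noteq> 0"
    using psd_mat_quadratic_zero[OF A(1,2) w(1)] w(2) by blast
  then have "0 < scalar_prod w (A *\<^sub>v w)" using A w by (simp add: psd_mat_def order_less_le)
  then have "0 < q f0" using f0(2) scalar_prod_self_nonneg[of w] by (simp add: zero_less_mult_iff)
  then have "0 < l" using f(2)[OF f0(1)] by (simp add: l_def)
  then show ?thesis using that v eig by blast
qed

section \<open>Matrices that are diagonal in an orthonormal family\<close>

definition orthonormal_family :: "nat \<Rightarrow> nat \<Rightarrow> (nat \<Rightarrow> real vec) \<Rightarrow> bool" where
  "orthonormal_family n m u \<longleftrightarrow> (\<forall>k<m. u k \<in> carrier_vec n) \<and>
     (\<forall>k<m. \<forall>l<m. scalar_prod (u k) (u l) = (if k = l then 1 else 0))"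

text \<open>The sum of the rank-one matrices built from the \<open>u k\<close>, weighted by
  \<open>c k\<close>. The family may be shorter than \<open>n\<close>; for an orthonormal one,
  vectors orthogonal to it are in the kernel.\<close>

definition spectral_mat :: "nat \<Rightarrow> nat \<Rightarrow> (nat \<Rightarrow> real vec) \<Rightarrow> (nat \<Rightarrow> real) \<Rightarrow> real mat" where
  "spectral_mat n m u c = mat n n (\<lambda>(i, j). \<Sum>k<m. c k * (u k $ i * u k $ j))"

lemma spectral_mat_carrier [simp]: "spectral_mat n m u c \<in> carrier_mat n n"
  by (simp add: spectral_mat_def)

lemma dim_spectral_mat [simp]:
  "dim_row (spectral_mat n m u c) = n" "dim_col (spectral_mat n m u c) = n"
  by (simp_all add: spectral_mat_def)

lemma transpose_spectral_mat: "transpose_mat (spectral_mat n m u c) = spectral_mat n m u c"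
  by (rule eq_matI) (auto simp: spectral_mat_def mult.commute intro!: sum.cong)

lemma spectral_mat_cong:
  "(\<And>k. k < m \<Longrightarrow> c k = d k) \<Longrightarrow> spectral_mat n m u c = spectral_mat n m u d"
  unfolding spectral_mat_def by (intro cong_mat) (auto intro!: sum.cong)

text \<open>Orthonormality removes the mixed terms, so products act on the coefficients alone. The
  identities for pseudoinverse and root thereby become identities between numbers.\<close>

lemma spectral_mat_mult:
  assumes "orthonormal_family n m u"
  shows "spectral_mat n m u c * spectral_mat n m u d = spectral_mat n m u (\<lambda>k. c k * d k)"
proof (rule eq_matI)
  fix i j assume "i < dim_row (spectral_mat n m u (\<lambda>k. c k * d k))"
    "j < dim_col (spectral_mat n m u (\<lambda>k. c k * d k))"
  then have ij: "i < n" "j < n" by (auto simp: spectral_mat_def)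
  have "(spectral_mat n m u c * spectral_mat n m u d) $$ (i, j) =
      (\<Sum>p<n. (\<Sum>k<m. c k * (u k $ i * u k $ p)) * (\<Sum>l<m. d l * (u l $ p * u l $ j)))"
    using ij by (simp add: spectral_mat_def scalar_prod_def lessThan_atLeast0)
  also have "\<dots> = (\<Sum>k<m. \<Sum>l<m. \<Sum>p<n. (c k * (u k $ i * u k $ p)) * (d l * (u l $ p * u l $ j)))"
    unfolding sum_product by (subst sum.swap, intro sum.cong refl sum.swap)
  also have "\<dots> = (\<Sum>k<m. \<Sum>l<m. c k * d l * (u k $ i * u l $ j) * scalar_prod (u k) (u l))"
  proof (intro sum.cong refl)
    fix k l assume "k \<in> {..<m}" "l \<in> {..<m}"
    then have "u l \<in> carrier_vec n" using assms by (simp add: orthonormal_family_def)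
    then show "(\<Sum>p<n. (c k * (u k $ i * u k $ p)) * (d l * (u l $ p * u l $ j))) =
        c k * d l * (u k $ i * u l $ j) * scalar_prod (u k) (u l)"
      by (simp add: scalar_prod_def sum_distrib_left lessThan_atLeast0 mult_ac)
  qed
  also have "\<dots> = (\<Sum>k<m. \<Sum>l<m. if l = k then c k * d k * (u k $ i * u k $ j) else 0)"
    using assms by (intro sum.cong refl) (auto simp: orthonormal_family_def)
  also have "\<dots> = spectral_mat n m u (\<lambda>k. c k * d k) $$ (i, j)"
    using ij by (simp add: spectral_mat_def)
  finally show "(spectral_mat n m u c * spectral_mat n m u d) $$ (i, j) =
      spectral_mat n m u (\<lambda>k. c k * d k) $$ (i, j)" .
qed (auto simp: spectral_mat_def)

lemma spectral_mat_mult_vec: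
  assumes "orthonormal_family n m u" "w \<in> carrier_vec n"
  shows "spectral_mat n m u c *\<^sub>v w = vec n (\<lambda>i. \<Sum>k<m. c k * scalar_prod (u k) w * u k $ i)"
proof (rule eq_vecI)
  fix i assume "i < dim_vec (vec n (\<lambda>i. \<Sum>k<m. c k * scalar_prod (u k) w * u k $ i))"
  then have i: "i < n" by simp
  have "(spectral_mat n m u c *\<^sub>v w) $ i = (\<Sum>p<n. (\<Sum>k<m. c k * (u k $ i * u k $ p)) * w $ p)"
    using i assms(2) by (simp add: spectral_mat_def scalar_prod_def lessThan_atLeast0)
  also have "\<dots> = (\<Sum>k<m. \<Sum>p<n. (c k * (u k $ i * u k $ p)) * w $ p)"
    unfolding sum_distrib_right by (rule sum.swap)
  also have "\<dots> = (\<Sum>k<m. c k * scalar_prod (u k) w * u k $ i)"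
    using assms(2)
    by (intro sum.cong refl)
      (simp add: scalar_prod_def sum_distrib_left sum_distrib_right lessThan_atLeast0 mult_ac)
  finally show "(spectral_mat n m u c *\<^sub>v w) $ i =
      vec n (\<lambda>i. \<Sum>k<m. c k * scalar_prod (u k) w * u k $ i) $ i"
    using i by simp
qed (simp add: spectral_mat_def)

lemma spectral_mat_mult_eigenvector:
  assumes "orthonormal_family n m u" "j < m"
  shows "spectral_mat n m u c *\<^sub>v u j = c j \<cdot>\<^sub>v u j"
proof -
  have uj: "u j \<in> carrier_vec n" using assms by (simp add: orthonormal_family_def)
  have "(\<Sum>k<m. c k * scalar_prod (u k) (u j) * u k $ i) = c j * u j $ i" for i
  proof -
    have "(\<Sum>k<m. c k * scalar_prod (u k) (u j) * u k $ i) =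
        (\<Sum>k<m. if k = j then c j * u j $ i else 0)"
      using assms by (intro sum.cong refl) (auto simp: orthonormal_family_def)
    then show ?thesis using assms(2) by simp
  qed
  then show ?thesis
    unfolding spectral_mat_mult_vec[OF assms(1) uj] using uj by (intro eq_vecI) auto
qed

lemma spectral_mat_quadratic:
  assumes "orthonormal_family n m u" "w \<in> carrier_vec n"
  shows "scalar_prod w (spectral_mat n m u c *\<^sub>v w) = (\<Sum>k<m. c k * (scalar_prod (u k) w)\<^sup>2)"
proof -
  have "scalar_prod w (spectral_mat n m u c *\<^sub>v w) =
      (\<Sum>p<n. w $ p * (\<Sum>k<m. c k * scalar_prod (u k) w * u k $ p))"
    by (simp add: spectral_mat_mult_vec[OF assms] scalar_prod_def lessThan_atLeast0)
  also have "\<dots> = (\<Sum>k<m. \<Sum>p<n. w $ p * (c k * scalar_prod (u k) w * u k $ p))"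
    unfolding sum_distrib_left by (rule sum.swap)
  also have "\<dots> = (\<Sum>k<m. c k * (scalar_prod (u k) w)\<^sup>2)"
  proof (intro sum.cong refl)
    fix k
    have "scalar_prod (u k) w = (\<Sum>p<n. u k $ p * w $ p)"
      using assms(2) by (simp add: scalar_prod_def lessThan_atLeast0)
    then show "(\<Sum>p<n. w $ p * (c k * scalar_prod (u k) w * u k $ p)) =
        c k * (scalar_prod (u k) w)\<^sup>2"
      unfolding power2_eq_square
      by (subst (3) \<open>scalar_prod (u k) w = _\<close>) (simp add: sum_distrib_left mult_ac)
  qed
  finally show ?thesis .
qed

lemma psd_spectral_mat:
  assumes "orthonormal_family n m u" "\<And>k. k < m \<Longrightarrow> 0 \<le> c k"
  shows "psd_mat (spectral_mat n m u c)"
  unfolding psd_mat_def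
  using spectral_mat_quadratic[OF assms(1)] assms(2)
  by (auto simp: square_mat.simps transpose_spectral_mat intro!: sum_nonneg)

text \<open>\<open>P\<close> is the orthogonal projection onto the span and has trace
  \<open>m\<close>. As \<open>P\<close> is symmetric and idempotent, each diagonal entry is the sum
  of the squares of its row, hence at least its own square and so at most 1. The trace is thus at
  most \<open>n\<close>.\<close>

lemma orthonormal_family_card_le:
  assumes "orthonormal_family n m u"
  shows "m \<le> n"
proof -
  define P where "P = spectral_mat n m u (\<lambda>_. 1)"
  have PP: "P * P = P" using spectral_mat_mult[OF assms, of "\<lambda>_. 1" "\<lambda>_. 1"] by (simp add: P_def)
  have "P $$ (j, j) \<le> 1" if "j < n" for j
  proof -
    have "P $$ (j, j) = (\<Sum>p<n. P $$ (j, p) * P $$ (p, j))"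
      using that by (subst PP[symmetric]) (simp add: P_def spectral_mat_def scalar_prod_def lessThan_atLeast0)
    also have "\<dots> = (\<Sum>p<n. P $$ (j, p) * P $$ (j, p))"
      using that by (intro sum.cong refl) (simp add: P_def spectral_mat_def mult.commute)
    also have "\<dots> \<ge> P $$ (j, j) * P $$ (j, j)"
      using that by (intro member_le_sum) auto
    finally have le: "P $$ (j, j) * P $$ (j, j) \<le> P $$ (j, j)" .
    show ?thesis
    proof (rule ccontr)
      assume "\<not> P $$ (j, j) \<le> 1"
      then have "P $$ (j, j) * 1 < P $$ (j, j) * P $$ (j, j)"
        by (intro mult_strict_left_mono) auto
      then show False using le by simp
    qed
  qed
  then have "(\<Sum>j<n. P $$ (j, j)) \<le> (\<Sum>j<n. 1)" by (intro sum_mono) auto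
  moreover have "(\<Sum>j<n. P $$ (j, j)) = (\<Sum>j<n. \<Sum>k<m. u k $ j * u k $ j)"
    by (intro sum.cong refl) (simp add: P_def spectral_mat_def)
  moreover have "\<dots> = (\<Sum>k<m. \<Sum>j<n. u k $ j * u k $ j)" by (rule sum.swap)
  moreover have "\<dots> = (\<Sum>k<m. 1)"
  proof (intro sum.cong refl)
    fix k assume "k \<in> {..<m}"
    then have "u k \<in> carrier_vec n" "scalar_prod (u k) (u k) = 1"
      using assms by (auto simp: orthonormal_family_def)
    then show "(\<Sum>j<n. u k $ j * u k $ j) = 1" by (simp add: scalar_prod_def lessThan_atLeast0)
  qed
  ultimately show ?thesis by simp
qed

text \<open>Take an orthonormal family of eigenvectors for positive eigenvalues that is as long as possible;
  an eigenvector of what remains would extend it.\<close>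

lemma psd_spectral_resolution:
  assumes A: "A \<in> carrier_mat n n" "psd_mat A"
  obtains m u l where "orthonormal_family n m u" "\<And>k. k < m \<Longrightarrow> 0 < l k"
    "A = spectral_mat n m u l"
proof -
  \<comment> \<open>\<open>Q m\<close> also records that the remainder is positive semidefinite and
    annihilates the family: the former supplies a further eigenvector, the latter makes it
    orthogonal to the earlier ones.\<close>
  define Q where "Q = (\<lambda>m. \<exists>u l. orthonormal_family n m u \<and> (\<forall>k<m. 0 < l k) \<and>
    psd_mat (A - spectral_mat n m u l) \<and>
    (\<forall>k<m. (A - spectral_mat n m u l) *\<^sub>v u k = 0\<^sub>v n))"
  have "A - spectral_mat n 0 u l = A" for u l
    using A(1) by (intro eq_matI) (auto simp: spectral_mat_def)
  then have "Q 0" using A by (auto simp: Q_def orthonormal_family_def)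
  moreover have "\<forall>m. Q m \<longrightarrow> m \<le> n" using orthonormal_family_card_le by (auto simp: Q_def)
  ultimately obtain m where m: "Q m" "\<And>m'. Q m' \<Longrightarrow> m' \<le> m"
    using ex_has_greatest_nat[of Q 0 "\<lambda>m. m" "Suc n"] by (auto simp: less_Suc_eq_le)
  obtain u l where u: "orthonormal_family n m u" and l: "\<forall>k<m. 0 < l k"
    and B: "psd_mat (A - spectral_mat n m u l)"
    and Bu: "\<forall>k<m. (A - spectral_mat n m u l) *\<^sub>v u k = 0\<^sub>v n"
    using m(1) unfolding Q_def by blast
  define B where "B = A - spectral_mat n m u l"
  have Bc: "B \<in> carrier_mat n n" unfolding B_def by (intro minus_carrier_mat spectral_mat_carrier)
  have Bsym: "transpose_mat B = B" using B by (simp add: B_def psd_mat_def)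
  have "B = 0\<^sub>m n n"
  proof (rule ccontr)
    assume "B \<noteq> 0\<^sub>m n n"
    then obtain c v where c: "0 < c" and v: "v \<in> carrier_vec n" "scalar_prod v v = 1"
      and Bv: "B *\<^sub>v v = c \<cdot>\<^sub>v v"
      using psd_mat_eigenvector[OF Bc] B by (auto simp: B_def)
    have vB: "scalar_prod v (B *\<^sub>v w) = c * scalar_prod v w" if "w \<in> carrier_vec n" for w
      using transpose_vec_mult_scalar[OF Bc that v(1)] that v by (simp add: Bsym Bv)
    have orth: "scalar_prod v (u k) = 0" if "k < m" for k
    proof -
      have "u k \<in> carrier_vec n" using u that by (simp add: orthonormal_family_def)
      then have "c * scalar_prod v (u k) = 0"
        using vB[of "u k"] Bu that v(1) by (simp flip: B_def)
      then show ?thesis using c by simp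
    qed
    define u' where "u' = u(m := v)"
    define l' where "l' = l(m := c)"
    define B' where "B' = A - spectral_mat n (Suc m) u' l'"
    have u': "orthonormal_family n (Suc m) u'"
    proof -
      have "scalar_prod (u k) v = 0" if "k < m" for k
        using orth[OF that] u v(1) that comm_scalar_prod[of v n "u k"]
        by (auto simp: orthonormal_family_def)
      then show ?thesis
        using u v orth by (auto simp: orthonormal_family_def u'_def less_Suc_eq)
    qed
    have B'c: "B' \<in> carrier_mat n n"
      unfolding B'_def by (intro minus_carrier_mat spectral_mat_carrier)
    have B'w: "B' *\<^sub>v w = B *\<^sub>v w - (c * scalar_prod v w) \<cdot>\<^sub>v v" if w: "w \<in> carrier_vec n" for w
    proof -
      have "spectral_mat n (Suc m) u' l' *\<^sub>v w = spectral_mat n m u l *\<^sub>v w + (c * scalar_prod v w) \<cdot>\<^sub>v v"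
        unfolding spectral_mat_mult_vec[OF u' w] spectral_mat_mult_vec[OF u w]
        using v(1) by (intro eq_vecI) (auto simp: u'_def l'_def)
      then show ?thesis
        unfolding B_def B'_def minus_mult_distrib_mat_vec[OF A(1) spectral_mat_carrier w]
        using A(1) w v(1) by (intro eq_vecI) (auto simp del: index_mult_mat_vec)
    qed
    \<comment> \<open>The form of \<open>B'\<close> at \<open>w\<close> is the form of
      \<open>B\<close> at \<open>w\<close> with its component along \<open>v\<close> removed, so
      positivity is inherited.\<close>
    have "0 \<le> scalar_prod w (B' *\<^sub>v w)" if w: "w \<in> carrier_vec n" for w
    proof -
      define s where "s = scalar_prod v w"
      have sw: "scalar_prod w v = s" using comm_scalar_prod[OF w v(1)] by (simp add: s_def)
      have "0 \<le> scalar_prod (w - s \<cdot>\<^sub>v v) (B *\<^sub>v (w - s \<cdot>\<^sub>v v))"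
        using B Bc v w by (simp add: psd_mat_def flip: B_def)
      also have "B *\<^sub>v (w - s \<cdot>\<^sub>v v) = B *\<^sub>v w - (s * c) \<cdot>\<^sub>v v"
        using Bc v(1) w
        by (simp add: mult_minus_distrib_mat_vec[OF Bc] mult_mat_vec[OF Bc] Bv smult_smult_assoc)
      also have "scalar_prod (w - s \<cdot>\<^sub>v v) (B *\<^sub>v w - (s * c) \<cdot>\<^sub>v v) =
          scalar_prod w (B *\<^sub>v w) - c * s\<^sup>2"
        using Bc v w
        by (simp add: minus_scalar_prod_distrib[of _ n] scalar_prod_minus_distrib[of _ n] sw vB
            power2_eq_square algebra_simps flip: s_def)
      also have "\<dots> = scalar_prod w (B' *\<^sub>v w)"
        using Bc v w
        by (simp add: B'w scalar_prod_minus_distrib[of _ n] sw power2_eq_square flip: s_def)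
      finally show ?thesis .
    qed
    moreover have "transpose_mat B' = B'"
      using A by (simp add: B'_def transpose_minus[of _ n n] transpose_spectral_mat psd_mat_def)
    ultimately have "psd_mat B'" using B'c by (simp add: psd_mat_def square_mat.simps)
    moreover have "B' *\<^sub>v u' k = 0\<^sub>v n" if "k < Suc m" for k
    proof (cases "k = m")
      case True
      then show ?thesis
        using B'w[OF v(1)] v by (auto simp: u'_def Bv)
    next
      case False
      then have k: "k < m" "u k \<in> carrier_vec n"
        using u that by (auto simp: orthonormal_family_def)
      then have "B *\<^sub>v u k = 0\<^sub>v n" using Bu by (simp add: B_def)
      then show ?thesis
        using B'w[OF k(2)] k v(1) False by (auto simp: u'_def orth)
    qed
    ultimately have "Q (Suc m)"
      unfolding Q_def using u' l c by (intro exI[of _ u'] exI[of _ l']) (auto simp: B'_def l'_def less_Suc_eq)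
    then show False using m(2) by fastforce
  qed
  have "A = spectral_mat n m u l"
  proof (rule eq_matI)
    fix i j assume "i < dim_row (spectral_mat n m u l)" "j < dim_col (spectral_mat n m u l)"
    then have ij: "i < n" "j < n" by (auto simp: spectral_mat_def)
    have "B $$ (i, j) = 0" using \<open>B = 0\<^sub>m n n\<close> ij by simp
    then show "A $$ (i, j) = spectral_mat n m u l $$ (i, j)"
      using ij A(1) by (simp add: B_def spectral_mat_def)
  qed (use A(1) in \<open>auto simp: spectral_mat_def\<close>)
  then show ?thesis using that u l by blast
qed

section \<open>Pseudoinverse and square root\<close>

text \<open>The body of the definite description in \<open>pinv\<close>, named so that existence and
  uniqueness can be proved separately.\<close>

definition is_pinv :: "real mat \<Rightarrow> real mat \<Rightarrow> bool" where
  "is_pinv A B \<longleftrightarrow> B \<in> carrier_mat (dim_col A) (dim_row A) \<and>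
     A * B * A = A \<and> B * A * B = B \<and>
     transpose_mat (A * B) = A * B \<and> transpose_mat (B * A) = B * A"

text \<open>\<open>A * B = A * C * (A * B)\<close> is a product of symmetric matrices; transposing
  swaps the factors and gives \<open>A * B * (A * C) = A * C\<close>. Likewise
  \<open>B * A = C * A\<close>, and then \<open>B = B * A * B = C * A * C = C\<close>.\<close>

lemma is_pinv_unique:
  assumes A: "A \<in> carrier_mat n n" and B: "is_pinv A B" and C: "is_pinv A C"
  shows "B = C"
proof -
  have c: "B \<in> carrier_mat n n" "C \<in> carrier_mat n n"
    using assms by (auto simp: is_pinv_def)
  have AB: "A * B = A * C"
  proof -
    have "A * B = A * C * (A * B)"
      using assoc_mult_mat[of "A * C" n n A n B n] A c C by (simp add: is_pinv_def del: assoc_mult_mat)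
    also have "\<dots> = transpose_mat (A * C) * transpose_mat (A * B)"
      using B C by (simp add: is_pinv_def)
    also have "\<dots> = transpose_mat (A * B * (A * C))"
      using A c by (intro transpose_mult[symmetric]) auto
    also have "A * B * (A * C) = A * C"
      using assoc_mult_mat[of "A * B" n n A n C n] A c B by (simp add: is_pinv_def del: assoc_mult_mat)
    also have "transpose_mat (A * C) = A * C" using C by (simp add: is_pinv_def)
    finally show ?thesis .
  qed
  have BA: "B * A = C * A"
  proof -
    have "B * A = B * A * (C * A)"
      using assoc_mult_mat[of B n n A n "C * A" n] assoc_mult_mat[of A n n C n A n] A c C
      by (simp add: is_pinv_def del: assoc_mult_mat)
    also have "\<dots> = transpose_mat (B * A) * transpose_mat (C * A)"
      using B C by (simp add: is_pinv_def)
    also have "\<dots> = transpose_mat (C * A * (B * A))"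
      using A c by (intro transpose_mult[symmetric]) auto
    also have "C * A * (B * A) = C * A"
      using assoc_mult_mat[of C n n A n "B * A" n] assoc_mult_mat[of A n n B n A n] A c B
      by (simp add: is_pinv_def del: assoc_mult_mat)
    also have "transpose_mat (C * A) = C * A" using C by (simp add: is_pinv_def)
    finally show ?thesis .
  qed
  have "B = B * A * B" using B by (simp add: is_pinv_def)
  also have "\<dots> = C * (A * B)" unfolding BA using A c by simp
  also have "\<dots> = C * A * C" unfolding AB using A c by simp
  also have "\<dots> = C" using C by (simp add: is_pinv_def)
  finally show ?thesis .
qed

text \<open>Inverting the coefficients of the spectral resolution gives a matrix whose products with
  \<open>A\<close>, on either side, are the orthogonal projection onto the span of the
  family.\<close>

lemma is_pinv_pinv:
  assumes A: "A \<in> carrier_mat n n" "psd_mat A"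
  shows "is_pinv A (pinv A)"
proof -
  obtain m u l where u: "orthonormal_family n m u" and l: "\<And>k. k < m \<Longrightarrow> 0 < l k"
    and res: "A = spectral_mat n m u l"
    using psd_spectral_resolution[OF A] by blast
  define B where "B = spectral_mat n m u (\<lambda>k. 1 / l k)"
  have AB: "A * B = spectral_mat n m u (\<lambda>_. 1)" "B * A = spectral_mat n m u (\<lambda>_. 1)"
    unfolding res B_def spectral_mat_mult[OF u]
    by (rule spectral_mat_cong, use l in fastforce)+
  have "A * B * A = A" "B * A * B = B"
    unfolding AB by (simp_all add: res B_def spectral_mat_mult[OF u])
  then have "is_pinv A B"
    unfolding is_pinv_def AB using A(1) by (simp add: transpose_spectral_mat B_def)
  moreover have "pinv A = (THE B. is_pinv A B)" by (simp add: pinv_def is_pinv_def)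
  ultimately show ?thesis
    using theI[of "is_pinv A" B] is_pinv_unique[OF A(1)] by metis
qed

text \<open>The root is determined on the \<open>u k\<close>, where positivity excludes the
  eigenvalue \<open>- sqrt (l k)\<close>, and on their orthogonal complement, where its square and
  hence the root itself vanishes.\<close>

lemma psd_root_unique:
  assumes u: "orthonormal_family n m u" and l: "\<And>k. k < m \<Longrightarrow> 0 < l k"
    and C: "C \<in> carrier_mat n n" "psd_mat C" "C * C = spectral_mat n m u l"
  shows "C = spectral_mat n m u (\<lambda>k. sqrt (l k))"
proof -
  have Cc: "C *\<^sub>v w \<in> carrier_vec n" if "w \<in> carrier_vec n" for w using that C(1) by auto
  have uc: "u k \<in> carrier_vec n" if "k < m" for k using u that by (simp add: orthonormal_family_def)
  have sq: "C *\<^sub>v (C *\<^sub>v w) = spectral_mat n m u l *\<^sub>v w" if "w \<in> carrier_vec n" for w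
    using that C(1) by (simp flip: C(3))
  have Cu: "C *\<^sub>v u k = sqrt (l k) \<cdot>\<^sub>v u k" if k: "k < m" for k
  proof -
    define s where "s = sqrt (l k)"
    have s: "0 < s" "s * s = l k" using l[OF k] by (auto simp: s_def)
    \<comment> \<open>Since \<open>C * C\<close> multiplies \<open>u k\<close> by
      \<open>s * s\<close>, the deviation \<open>w\<close> satisfies
      \<open>C *\<^sub>v w = (- s) \<cdot>\<^sub>v w\<close>, and semidefiniteness leaves only
      \<open>w = 0\<close>.\<close>
    define w where "w = C *\<^sub>v u k - s \<cdot>\<^sub>v u k"
    have w: "w \<in> carrier_vec n" using Cc uc[OF k] by (simp add: w_def)
    have "C *\<^sub>v w = l k \<cdot>\<^sub>v u k - s \<cdot>\<^sub>v (C *\<^sub>v u k)"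
      unfolding w_def using C(1) uc[OF k] Cc[OF uc[OF k]] sq[OF uc[OF k]]
      by (simp add: mult_minus_distrib_mat_vec[OF C(1)] mult_mat_vec[OF C(1)]
          spectral_mat_mult_eigenvector[OF u k])
    also have "\<dots> = (- s) \<cdot>\<^sub>v w"
      unfolding w_def using C(1) uc[OF k] s
      by (intro eq_vecI) (auto simp: algebra_simps simp flip: s(2))
    finally have "scalar_prod w (C *\<^sub>v w) = - s * scalar_prod w w" using w by simp
    moreover have "0 \<le> scalar_prod w (C *\<^sub>v w)" using C w by (simp add: psd_mat_def)
    ultimately have "scalar_prod w w \<le> 0" using s by (simp add: mult_le_0_iff)
    then have "w = 0\<^sub>v n" using scalar_prod_self_eq_0[OF w] scalar_prod_self_nonneg[of w] by linarith
    show ?thesis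
    proof (rule eq_vecI)
      fix i assume "i < dim_vec (sqrt (l k) \<cdot>\<^sub>v u k)"
      then have i: "i < n" using uc[OF k] by simp
      then have "w $ i = 0" using \<open>w = 0\<^sub>v n\<close> by simp
      then show "(C *\<^sub>v u k) $ i = (sqrt (l k) \<cdot>\<^sub>v u k) $ i"
        using i uc[OF k] by (simp add: w_def s_def)
    qed (use C(1) uc[OF k] in auto)
  qed
  have kernel: "C *\<^sub>v w = 0\<^sub>v n"
    if w: "w \<in> carrier_vec n" and orth: "\<And>k. k < m \<Longrightarrow> scalar_prod (u k) w = 0" for w
  proof -
    have "C *\<^sub>v (C *\<^sub>v w) = 0\<^sub>v n"
      unfolding sq[OF w] spectral_mat_mult_vec[OF u w] by (intro eq_vecI) (auto simp: orth)
    then have "scalar_prod (C *\<^sub>v w) (C *\<^sub>v w) = 0"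
      using transpose_vec_mult_scalar[OF C(1) Cc[OF w] w] C(2) w
      by (simp add: psd_mat_def comm_scalar_prod[OF _ Cc[OF w]])
    then show ?thesis using scalar_prod_self_eq_0[OF Cc[OF w]] by simp
  qed
  define R where "R = spectral_mat n m u (\<lambda>k. sqrt (l k))"
  define P where "P = spectral_mat n m u (\<lambda>_. 1)"
  have "C *\<^sub>v v = R *\<^sub>v v" if v: "v \<in> carrier_vec n" for v
  proof -
    \<comment> \<open>\<open>p\<close> is the projection of \<open>v\<close> onto the span:
      \<open>C\<close> annihilates \<open>v - p\<close>, and on \<open>p\<close> it acts through
      \<open>C * P = R\<close>.\<close>
    define p where "p = P *\<^sub>v v"
    have p: "p \<in> carrier_vec n" unfolding p_def P_def by (rule mult_mat_vec_carrier[OF spectral_mat_carrier v])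
    have "scalar_prod (u k) (v - p) = 0" if k: "k < m" for k
    proof -
      have "scalar_prod (u k) p = scalar_prod (P *\<^sub>v u k) v"
        using transpose_vec_mult_scalar[of P n n v "u k"] v uc[OF k]
        by (simp add: P_def p_def transpose_spectral_mat)
      then show ?thesis
        using uc[OF k] v p spectral_mat_mult_eigenvector[OF u k, of "\<lambda>_. 1"]
        by (simp add: P_def scalar_prod_minus_distrib[of _ n])
    qed
    then have "C *\<^sub>v (v - p) = 0\<^sub>v n" using kernel v p by simp
    then have "C *\<^sub>v v - C *\<^sub>v p = 0\<^sub>v n"
      using mult_minus_distrib_mat_vec[OF C(1) v p] by simp
    moreover have "(C *\<^sub>v v - C *\<^sub>v p) $ i = (C *\<^sub>v v) $ i - (C *\<^sub>v p) $ i" if "i < n" for i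
      using that C(1) by simp
    ultimately have "(C *\<^sub>v v) $ i = (C *\<^sub>v p) $ i" if "i < n" for i
      using that by (metis eq_iff_diff_eq_0 index_zero_vec(1))
    moreover have "C *\<^sub>v p = R *\<^sub>v v"
    proof -
      have "C * P = R"
      proof (rule eq_matI)
        fix i j assume "i < dim_row R" "j < dim_col R"
        then have ij: "i < n" "j < n" by (auto simp: R_def)
        have "(C * P) $$ (i, j) = (\<Sum>p<n. C $$ (i, p) * (\<Sum>k<m. u k $ p * u k $ j))"
          using ij C(1) by (simp add: P_def spectral_mat_def scalar_prod_def lessThan_atLeast0)
        also have "\<dots> = (\<Sum>k<m. \<Sum>p<n. C $$ (i, p) * (u k $ p * u k $ j))"
          unfolding sum_distrib_left by (rule sum.swap)
        also have "\<dots> = (\<Sum>k<m. (C *\<^sub>v u k) $ i * u k $ j)"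
        proof (intro sum.cong refl)
          fix k assume "k \<in> {..<m}"
          then have "dim_vec (u k) = n" using uc[of k] by auto
          then have "(C *\<^sub>v u k) $ i = (\<Sum>p<n. C $$ (i, p) * u k $ p)"
            using ij C(1) by (simp add: scalar_prod_def lessThan_atLeast0)
          then show "(\<Sum>p<n. C $$ (i, p) * (u k $ p * u k $ j)) = (C *\<^sub>v u k) $ i * u k $ j"
            by (simp add: sum_distrib_right mult.assoc)
        qed
        also have "\<dots> = (\<Sum>k<m. sqrt (l k) * (u k $ i * u k $ j))"
        proof (intro sum.cong refl)
          fix k assume "k \<in> {..<m}"
          then show "(C *\<^sub>v u k) $ i * u k $ j = sqrt (l k) * (u k $ i * u k $ j)"
            unfolding Cu[of k, OF lessThan_iff[THEN iffD1]] using uc[of k] ij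
            by (simp add: Cu del: index_mult_mat_vec)
        qed
        also have "\<dots> = R $$ (i, j)" using ij by (simp add: R_def spectral_mat_def)
        finally show "(C * P) $$ (i, j) = R $$ (i, j)" .
      qed (use C(1) in \<open>auto simp: P_def R_def\<close>)
      then show ?thesis
        using assoc_mult_mat_vec[OF C(1) _ v, of P] by (simp add: p_def P_def)
    qed
    ultimately show ?thesis
      using C(1) by (intro eq_vecI) (auto simp: R_def simp del: index_mult_mat_vec)
  qed
  then have *: "C *\<^sub>v unit_vec n j = R *\<^sub>v unit_vec n j" for j by simp
  have entry: "(M *\<^sub>v unit_vec n j) $ i = M $$ (i, j)"
    if "M \<in> carrier_mat n n" "i < n" "j < n" for M :: "real mat" and i j
    using that by simp
  have "C = R"
  proof (rule eq_matI)
    fix i j assume "i < dim_row R" "j < dim_col R"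
    then have "i < n" "j < n" by (auto simp: R_def)
    then show "C $$ (i, j) = R $$ (i, j)"
      using entry[OF C(1), of i j] entry[of R i j] * by (simp add: R_def)
  qed (use C(1) in \<open>auto simp: R_def\<close>)
  then show ?thesis by (simp add: R_def)
qed

lemma psd_sqrt_squared:
  assumes A: "A \<in> carrier_mat n n" "psd_mat A"
  shows "psd_sqrt A \<in> carrier_mat n n" "psd_sqrt A * psd_sqrt A = A"
proof -
  obtain m u l where u: "orthonormal_family n m u" and l: "\<And>k. k < m \<Longrightarrow> 0 < l k"
    and res: "A = spectral_mat n m u l"
    using psd_spectral_resolution[OF A] by blast
  define R where "R = spectral_mat n m u (\<lambda>k. sqrt (l k))"
  have dim: "dim_row A = n" using A(1) by simp
  have "R * R = A"
    unfolding R_def spectral_mat_mult[OF u] res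
    by (rule spectral_mat_cong) (use l in \<open>simp add: less_imp_le\<close>)
  moreover have "psd_mat R"
    unfolding R_def by (rule psd_spectral_mat[OF u]) (use l in \<open>simp add: less_imp_le\<close>)
  ultimately have root: "R \<in> carrier_mat n n \<and> psd_mat R \<and> R * R = A" by (simp add: R_def)
  have unique: "B = R" if "B \<in> carrier_mat n n \<and> psd_mat B \<and> B * B = A" for B
    using that psd_root_unique[OF u l, where C = B] by (simp add: R_def res)
  have "psd_sqrt A = R"
    unfolding psd_sqrt_def dim by (rule the_equality, rule root, erule unique)
  then show "psd_sqrt A \<in> carrier_mat n n" "psd_sqrt A * psd_sqrt A = A"
    using \<open>R * R = A\<close> by (simp_all add: R_def)
qed

text \<open>Cauchy-Schwarz bounds the left side by \<open>p * (vnorm y)\<^sup>2\<close>, and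
  \<open>p\<close> is then enlarged to the product on the right. For \<open>A = 0\<close>, where
  \<open>a * p\<close> is not at least 1, the hypothesis \<open>range\<close> gives
  \<open>y = 0\<close>.\<close>

lemma pinv_quadratic_le:
  assumes A: "A \<in> carrier_mat n n" "psd_mat A" and y: "y \<in> carrier_vec n"
    and range: "A *\<^sub>v (pinv A *\<^sub>v y) = y"
  shows "scalar_prod y (pinv A *\<^sub>v y) \<le>
    (op_norm (psd_sqrt A))\<^sup>2 * (op_norm (pinv A))\<^sup>2 * (cond_num A)\<^sup>2 * (vnorm y)\<^sup>2"
proof -
  define a p r where "a = op_norm A" and "p = op_norm (pinv A)" and "r = op_norm (psd_sqrt A)"
  have nonneg: "0 \<le> a" "0 \<le> p" by (simp_all add: a_def p_def op_norm_nonneg)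
  have P: "pinv A \<in> carrier_mat n n" "A * pinv A * A = A"
    using is_pinv_pinv[OF A] A by (auto simp: is_pinv_def)
  have "a \<le> r * r"
    using op_norm_mult_le[OF psd_sqrt_squared(1)[OF A] psd_sqrt_squared(1)[OF A]]
    by (simp add: psd_sqrt_squared(2)[OF A] a_def r_def)
  have Py: "pinv A *\<^sub>v y \<in> carrier_vec n" using P y by auto
  have "scalar_prod y (pinv A *\<^sub>v y) \<le> vnorm y * vnorm (pinv A *\<^sub>v y)"
    using scalar_prod_Cauchy_Schwarz[OF y Py] by linarith
  also have "\<dots> \<le> vnorm y * (p * vnorm y)"
    unfolding p_def by (intro mult_left_mono vnorm_mult_mat_vec_le[OF P(1) y] vnorm_nonneg)
  also have "\<dots> = p * (vnorm y)\<^sup>2" by (simp add: power2_eq_square)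
  also have "\<dots> \<le> r\<^sup>2 * p\<^sup>2 * (a * p)\<^sup>2 * (vnorm y)\<^sup>2"
  proof (cases "a = 0")
    case True
    then have "A = 0\<^sub>m n n" using op_norm_eq_0[OF A(1)] by (simp add: a_def)
    then have "A *\<^sub>v (pinv A *\<^sub>v y) = 0\<^sub>v n" using Py by (intro eq_vecI) auto
    then have "y = 0\<^sub>v n" using range by simp
    then show ?thesis by (simp add: vnorm_def)
  next
    case False
    have "a \<le> op_norm (A * pinv A) * op_norm A"
      using op_norm_mult_le[of "A * pinv A" n n A n] A(1) P by (simp add: a_def)
    also have "\<dots> \<le> a * p * a"
      unfolding a_def p_def
      by (intro mult_right_mono op_norm_mult_le[OF A(1) P(1)] op_norm_nonneg)
    finally have "1 * a \<le> (a * p) * a" by simp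
    then have ap: "1 \<le> a * p" using False nonneg by (subst (asm) mult_le_cancel_right) auto
    \<comment> \<open>The exponent 3 leaves exactly one factor \<open>a\<close> besides
      \<open>p\<^sup>2 * (a * p)\<^sup>2\<close>, to be replaced by \<open>r * r\<close>.\<close>
    have "p * 1 \<le> p * (a * p) ^ 3" using ap nonneg by (intro mult_left_mono one_le_power) auto
    also have "\<dots> = a * (p\<^sup>2 * (a * p)\<^sup>2)" by (simp add: power2_eq_square power3_eq_cube)
    also have "\<dots> \<le> r * r * (p\<^sup>2 * (a * p)\<^sup>2)"
      using \<open>a \<le> r * r\<close> by (intro mult_right_mono) auto
    finally have "p \<le> r\<^sup>2 * p\<^sup>2 * (a * p)\<^sup>2" by (simp add: power2_eq_square mult.assoc)
    then show ?thesis by (rule mult_right_mono) simp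
  qed
  finally show ?thesis by (simp add: a_def p_def r_def cond_num_def)
qed

section \<open>Minimum-norm interpolation\<close>

text \<open>The first point is fitted by a multiple of its section, the other labels are corrected,
  and the kernel is replaced by its Schur complement. For a reproducing kernel the new sections
  vanish at \<open>a\<close>, so the fitted value is kept. If \<open>k a a = 0\<close>, the
  quotients are 0 and the point is passed over. Being an explicit formula, it lends itself to a
  proof of measurability by induction.\<close>

fun successive_interpolant :: "('x \<Rightarrow> 'x \<Rightarrow> real) \<Rightarrow> ('x \<times> real) list \<Rightarrow> 'x \<Rightarrow> real" where
  "successive_interpolant k [] = (\<lambda>x. 0)"
| "successive_interpolant k ((a, y) # zs) =
     (\<lambda>x. y / k a a * k a x +
        successive_interpolant (\<lambda>s t. k s t - k s a / k a a * k a t)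
          (map (\<lambda>(b, t). (b, t - y / k a a * k a b)) zs) x)"

context rkhs
begin

section \<open>Inner product algebra in the Hilbert space\<close>

lemma ip_add_right: "f \<in> H \<Longrightarrow> g \<in> H \<Longrightarrow> h \<in> H \<Longrightarrow> ip h (\<lambda>x. f x + g x) = ip h f + ip h g"
  by (simp add: ip_commute[of h] ip_add_left add_mem)

lemma ip_scale_right: "f \<in> H \<Longrightarrow> g \<in> H \<Longrightarrow> ip g (\<lambda>x. a * f x) = a * ip g f"
  by (simp add: ip_commute[of g] ip_scale_left scale_mem)

lemma ip_zero_right: "f \<in> H \<Longrightarrow> ip f (\<lambda>_. 0) = 0"
  using ip_scale_right[of f f 0] by simp

lemma diff_mem: "f \<in> H \<Longrightarrow> g \<in> H \<Longrightarrow> (\<lambda>x. f x - g x) \<in> H"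
  using add_mem[of f "\<lambda>x. (-1) * g x"] scale_mem[of g "-1"] by simp

lemma ip_diff_scale_right:
  assumes "f \<in> H" "g \<in> H" "h \<in> H"
  shows "ip h (\<lambda>x. f x - c * g x) = ip h f - c * ip h g"
  using ip_add_right[of f "\<lambda>x. (-c) * g x" h] ip_scale_right[of g h "-c"] scale_mem[of g "-c"] assms
  by simp

text \<open>Expand the squared norm of the combination with coefficients \<open>ip g g\<close> of
  \<open>f\<close> and \<open>- ip f g\<close> of \<open>g\<close>.\<close>

lemma ip_Cauchy_Schwarz:
  assumes "f \<in> H" "g \<in> H"
  shows "(ip f g)\<^sup>2 \<le> ip f f * ip g g"
proof (cases "ip g g = 0")
  case True
  then have "g = (\<lambda>_. 0)" using assms ip_definite by blast
  then show ?thesis using True assms ip_zero_right by simp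
next
  case False
  then have pos: "0 < ip g g" using ip_nonneg[OF assms(2)] by simp
  define a b where "a = ip g g" and "b = - ip f g"
  have "0 \<le> ip (\<lambda>x. a * f x + b * g x) (\<lambda>x. a * f x + b * g x)"
    using assms by (intro ip_nonneg add_mem scale_mem)
  also have "\<dots> = a * a * ip f f + 2 * a * b * ip f g + b * b * ip g g"
    using assms
    by (simp add: ip_add_left ip_add_right ip_scale_left ip_scale_right add_mem scale_mem
        ip_commute[of g f] algebra_simps)
  also have "\<dots> = ip g g * (ip f f * ip g g - (ip f g)\<^sup>2)"
    by (simp add: a_def b_def power2_eq_square algebra_simps)
  finally show ?thesis using pos by (simp add: zero_le_mult_iff)
qed

lemma kernel_section_ip:
  "x \<in> X \<Longrightarrow> x' \<in> X \<Longrightarrow> ip (kernel_section X K x) (kernel_section X K x') = K x x'"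
  using reproducing[of "kernel_section X K x" x'] section_mem by (simp add: kernel_section_def)

lemma eval_bound:
  assumes "f \<in> H" "x \<in> X"
  shows "(f x)\<^sup>2 \<le> K x x * ip f f"
  using ip_Cauchy_Schwarz[OF assms(1) section_mem[OF assms(2)]] reproducing[OF assms]
    kernel_section_ip[OF assms(2,2)]
  by (simp only: mult.commute)

lemma section_combination:
  fixes n :: nat
  assumes "\<And>j. j < n \<Longrightarrow> x j \<in> X"
  shows "(\<lambda>t. \<Sum>j<n. a j * kernel_section X K (x j) t) \<in> H \<and>
    (\<forall>f\<in>H. ip f (\<lambda>t. \<Sum>j<n. a j * kernel_section X K (x j) t) = (\<Sum>j<n. a j * f (x j)))"
  using assms
proof (induction n)
  case 0
  then show ?case by (simp add: zero_mem ip_zero_right)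
next
  case (Suc n)
  then show ?case
    by (simp add: add_mem scale_mem section_mem ip_add_right ip_scale_right reproducing)
qed

text \<open>A subspace of \<open>H\<close> with its own reproducing kernel for the inherited inner
  product. The recursion descends to the functions vanishing at the points already treated.\<close>

definition reproduces :: "('x \<Rightarrow> real) set \<Rightarrow> ('x \<Rightarrow> 'x \<Rightarrow> real) \<Rightarrow> bool" where
  "reproduces V k \<longleftrightarrow> V \<subseteq> H \<and> (\<forall>f\<in>V. \<forall>g\<in>V. (\<lambda>x. f x + g x) \<in> V) \<and>
     (\<forall>f\<in>V. \<forall>c. (\<lambda>x. c * f x) \<in> V) \<and> (\<forall>x\<in>X. k x \<in> V) \<and>
     (\<forall>f\<in>V. \<forall>x\<in>X. ip f (k x) = f x)"

lemma reproduces_kernel: "reproduces H (kernel_section X K)"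
  by (simp add: reproduces_def add_mem scale_mem section_mem reproducing)

lemma reproduces_diff_scale_mem:
  assumes "reproduces V k" "f \<in> V" "g \<in> V"
  shows "(\<lambda>x. f x - c * g x) \<in> V"
proof -
  have add: "\<forall>f\<in>V. \<forall>g\<in>V. (\<lambda>x. f x + g x) \<in> V" and scale: "\<forall>f\<in>V. \<forall>c. (\<lambda>x. c * f x) \<in> V"
    using assms(1) by (simp_all add: reproduces_def)
  show ?thesis
    using add[THEN bspec, THEN bspec, OF assms(2) scale[THEN bspec, THEN spec, OF assms(3), of "-c"]]
    by simp
qed

text \<open>\<open>k a a\<close> is the squared norm of \<open>k a\<close>. This settles the
  divisions by zero in the recursion.\<close>

lemma reproduces_degenerate:
  assumes "reproduces V k" "a \<in> X" "k a a = 0"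
  shows "k a = (\<lambda>_. 0)" and "f \<in> V \<Longrightarrow> f a = 0"
proof -
  have ka: "k a \<in> V" "k a \<in> H" using assms by (auto simp: reproduces_def)
  moreover have "ip (k a) (k a) = 0" using assms ka by (simp add: reproduces_def)
  ultimately show *: "k a = (\<lambda>_. 0)" using ip_definite by blast
  assume "f \<in> V"
  then have "f a = ip f (k a)" "f \<in> H" using assms by (auto simp: reproduces_def)
  then show "f a = 0" using * ip_zero_right by simp
qed

text \<open>The functions vanishing at \<open>a\<close> have as reproducing kernel the Schur complement.\<close>

lemma reproduces_deflate:
  assumes V: "reproduces V k" and a: "a \<in> X"
  shows "reproduces {f \<in> V. f a = 0} (\<lambda>s t. k s t - k s a / k a a * k a t)"
proof -
  have V_H: "\<And>f. f \<in> V \<Longrightarrow> f \<in> H" using V by (auto simp: reproduces_def)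
  have mem: "(\<lambda>t. k s t - k s a / k a a * k a t) \<in> V" if "s \<in> X" for s
    by (rule reproduces_diff_scale_mem[OF V]) (use V a that in \<open>auto simp: reproduces_def\<close>)
  have "k s a - k s a / k a a * k a a = 0" if "s \<in> X" for s
    using reproduces_degenerate(2)[OF V a, of "k s"] V that
    by (cases "k a a = 0") (auto simp: reproduces_def)
  moreover have "ip f (\<lambda>t. k s t - k s a / k a a * k a t) = f s"
    if "s \<in> X" "f \<in> V" "f a = 0" for f s
  proof -
    have "k s \<in> V" "k a \<in> V" "ip f (k s) = f s" "ip f (k a) = 0"
      using V a that by (auto simp: reproduces_def)
    then show ?thesis
      using ip_diff_scale_right[of "k s" "k a" f "k s a / k a a"] V_H that by simp
  qed
  ultimately show ?thesis
    using V mem by (auto simp: reproduces_def)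
qed

text \<open>\<open>f\<close> witnesses that the labels are consistent. The orthogonality, which will
  give minimality, survives a step: a function \<open>h\<close> vanishing at all points satisfies
  \<open>ip (k a) h = h a = 0\<close> and belongs to the smaller space, where the induction
  hypothesis applies.\<close>

lemma successive_interpolant_orthogonal:
  assumes "reproduces V k" "\<forall>z\<in>set zs. fst z \<in> X" "f \<in> V" "\<forall>z\<in>set zs. f (fst z) = snd z"
  shows "successive_interpolant k zs \<in> V \<and>
    (\<forall>z\<in>set zs. successive_interpolant k zs (fst z) = snd z) \<and>
    (\<forall>h\<in>V. (\<forall>z\<in>set zs. h (fst z) = 0) \<longrightarrow> ip (successive_interpolant k zs) h = 0)"
  using assms
proof (induction k zs arbitrary: V f rule: successive_interpolant.induct)
  case (1 k)
  have "(\<lambda>x. 0 * f x) \<in> V" "V \<subseteq> H" using 1 unfolding reproduces_def by blast+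
  then show ?case using ip_commute[OF zero_mem] ip_zero_right by (auto simp: subset_iff)
next
  case (2 k a y zs)
  define c where "c = y / k a a"
  define k' where "k' = (\<lambda>s t. k s t - k s a / k a a * k a t)"
  define zs' where "zs' = map (\<lambda>(b, t). (b, t - c * k a b)) zs"
  define V' where "V' = {f \<in> V. f a = 0}"
  define g where "g = successive_interpolant k' zs'"
  define f' where "f' = (\<lambda>x. f x - c * k a x)"
  have a: "a \<in> X" and fa: "f a = y" using 2 by auto
  have V_H: "\<And>f. f \<in> V \<Longrightarrow> f \<in> H" using 2 by (auto simp: reproduces_def)
  have ka: "k a \<in> V" using 2(2) a by (simp add: reproduces_def)
  \<comment> \<open>If \<open>k a a = 0\<close>, then the witness has \<open>f a = 0\<close>, so
    \<open>y = 0\<close> agrees with the default value \<open>c = 0\<close>.\<close>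
  have cy: "c * k a a = y"
    using reproduces_degenerate(2)[OF 2(2) a _ 2(4)] fa by (cases "k a a = 0") (auto simp: c_def)
  have "f' \<in> V'"
    using reproduces_diff_scale_mem[OF 2(2,4) ka, of c] fa cy by (simp add: f'_def V'_def)
  moreover have "reproduces V' k'"
    unfolding V'_def k'_def by (rule reproduces_deflate[OF 2(2) a])
  moreover have "\<forall>z\<in>set zs'. fst z \<in> X" "\<forall>z\<in>set zs'. f' (fst z) = snd z"
    using 2(3,5) by (auto simp: zs'_def f'_def)
  ultimately have g: "g \<in> V'" "\<forall>z\<in>set zs'. g (fst z) = snd z"
    "\<forall>h\<in>V'. (\<forall>z\<in>set zs'. h (fst z) = 0) \<longrightarrow> ip g h = 0"
    using 2(1)[of V' f'] unfolding g_def k'_def zs'_def c_def by blast+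
  have eq: "successive_interpolant k ((a, y) # zs) = (\<lambda>x. c * k a x + g x)"
    by (simp add: g_def k'_def zs'_def c_def)
  have gV: "g \<in> V" "g a = 0" using g(1) by (auto simp: V'_def)
  have "(\<lambda>x. c * k a x + g x) \<in> V" using 2(2) ka gV by (simp add: reproduces_def)
  moreover have "c * k a (fst z) + g (fst z) = snd z" if "z \<in> set ((a, y) # zs)" for z
  proof (cases "z = (a, y)")
    case True
    then show ?thesis using cy gV by simp
  next
    case False
    then have "(fst z, snd z - c * k a (fst z)) \<in> set zs'"
      using that by (force simp: zs'_def)
    then show ?thesis using g(2) by fastforce
  qed
  moreover have "ip (\<lambda>x. c * k a x + g x) h = 0"
    if h: "h \<in> V" "\<forall>z\<in>set ((a, y) # zs). h (fst z) = 0" for h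
  proof -
    have "ip (k a) h = h a"
      using ip_commute[of "k a" h] V_H ka h(1) 2(2) a by (simp add: reproduces_def)
    moreover have "ip g h = 0"
    proof (rule g(3)[THEN bspec, THEN mp])
      show "h \<in> V'" using h by (simp add: V'_def)
      show "\<forall>z\<in>set zs'. h (fst z) = 0" using h by (auto simp: zs'_def)
    qed
    ultimately show ?thesis
      using h V_H ka gV by (simp add: ip_add_left ip_scale_left scale_mem)
  qed
  ultimately show ?case unfolding eq by blast
qed

section \<open>Minimality and uniqueness from orthogonality\<close>

lemma ip_Pythagoras:
  assumes "f \<in> H" "g \<in> H" "ip g (\<lambda>x. f x - g x) = 0"
  shows "ip f f = ip g g + ip (\<lambda>x. f x - g x) (\<lambda>x. f x - g x)"
proof -
  define e where "e = (\<lambda>x. f x - g x)"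
  have e: "e \<in> H" unfolding e_def by (rule diff_mem[OF assms(1,2)])
  have "f = (\<lambda>x. g x + e x)" by (simp add: e_def)
  then have "ip f f = ip (\<lambda>x. g x + e x) (\<lambda>x. g x + e x)" by simp
  also have "\<dots> = ip g g + ip e e"
    using assms e ip_commute[OF assms(2) e]
    by (simp add: ip_add_left ip_add_right add_mem flip: e_def)
  finally show ?thesis by (simp add: e_def)
qed

text \<open>\<open>f - g\<close> vanishes at all points, so it is orthogonal to \<open>g\<close>.
  For arbitrary \<open>f\<close> this shows minimality; for the interpolant of a larger sample it
  bounds the distance to \<open>g\<close>.\<close>

lemma successive_interpolant_interpolants:
  assumes "f \<in> interpolants H J S" "\<And>j. j \<in> J \<Longrightarrow> fst (S j) \<in> X" "set js = J"
  defines "g \<equiv> successive_interpolant (kernel_section X K) (map S js)"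
  shows "g \<in> interpolants H J S" "ip f f = ip g g + ip (\<lambda>x. f x - g x) (\<lambda>x. f x - g x)"
proof -
  have f: "f \<in> H" "\<forall>z\<in>set (map S js). f (fst z) = snd z"
    using assms by (auto simp: interpolants_def)
  have X: "\<forall>z\<in>set (map S js). fst z \<in> X" using assms by auto
  note g = successive_interpolant_orthogonal[OF reproduces_kernel X f, folded g_def]
  then show "g \<in> interpolants H J S" using assms(3) by (auto simp: interpolants_def)
  have gH: "g \<in> H" using g by (rule conjunct1)
  have fg: "(\<lambda>x. f x - g x) \<in> H" by (rule diff_mem[OF f(1) gH])
  have "\<forall>z\<in>set (map S js). f (fst z) - g (fst z) = 0" using f g by simp
  then have "ip g (\<lambda>x. f x - g x) = 0"
    using g[THEN conjunct2, THEN conjunct2, THEN bspec, OF fg] by (rule rev_mp)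
  then show "ip f f = ip g g + ip (\<lambda>x. f x - g x) (\<lambda>x. f x - g x)"
    by (rule ip_Pythagoras[OF f(1) gH])
qed

text \<open>A minimizer has the norm of \<open>g\<close>, so Pythagoras makes its difference from
  \<open>g\<close> zero. This pins down the choice made by \<open>arg_min\<close>, whatever the
  order of \<open>js\<close>.\<close>

lemma min_norm_interpolant_eq:
  assumes "interpolants H J S \<noteq> {}" "\<And>j. j \<in> J \<Longrightarrow> fst (S j) \<in> X" "set js = J"
  shows "min_norm_interpolant H ip J S = successive_interpolant (kernel_section X K) (map S js)"
proof -
  define g where "g = successive_interpolant (kernel_section X K) (map S js)"
  define m where "m = min_norm_interpolant H ip J S"
  note * = successive_interpolant_interpolants[of _ J S js, OF _ assms(2,3), folded g_def]
  have g: "g \<in> interpolants H J S" using assms(1) *(1) by blast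
  have H: "f \<in> H" if "f \<in> interpolants H J S" for f using that by (simp add: interpolants_def)
  have le: "hnorm ip g \<le> hnorm ip f" if "f \<in> interpolants H J S" for f
    using *(2)[OF that] ip_nonneg[OF diff_mem[OF H[OF that] H[OF g]]] by (simp add: hnorm_def)
  have "m \<in> interpolants H J S \<and> hnorm ip m = hnorm ip g"
  proof
    show "m \<in> interpolants H J S"
      unfolding m_def min_norm_interpolant_def
      by (rule arg_minI[of _ g]) (use g le in \<open>auto simp: not_less\<close>)
    show "hnorm ip m = hnorm ip g"
      unfolding m_def min_norm_interpolant_def
      by (rule arg_min_equality[where P = "\<lambda>f. f \<in> interpolants H J S"]) (use g le in auto)
  qed
  then have "m \<in> interpolants H J S" "ip (\<lambda>x. m x - g x) (\<lambda>x. m x - g x) = 0"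
    using *(2)[of m] by (auto simp: hnorm_def)
  then have "(\<lambda>x. m x - g x) = (\<lambda>_. 0)" using ip_definite diff_mem H g by blast
  then have "m = g" by (simp add: fun_eq_iff)
  then show ?thesis by (simp add: m_def g_def)
qed

end

section \<open>The leave-one-out error\<close>

context rkhs
begin

definition sample_combination :: "nat \<Rightarrow> (nat \<Rightarrow> 'x \<times> real) \<Rightarrow> real vec \<Rightarrow> 'x \<Rightarrow> real" where
  "sample_combination n S a = (\<lambda>t. \<Sum>j<n. a $ j * kernel_section X K (fst (S j)) t)"

lemma kernel_sym: "x \<in> X \<Longrightarrow> x' \<in> X \<Longrightarrow> K x x' = K x' x"
  using ip_commute[of "kernel_section X K x" "kernel_section X K x'"]
  by (simp add: kernel_section_ip section_mem)

lemma kernel_mat_carrier [simp]: "kernel_mat K n S \<in> carrier_mat n n"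
  by (simp add: kernel_mat_def)

context
  fixes n :: nat and S :: "nat \<Rightarrow> 'x \<times> real"
  assumes points: "\<And>j. j < n \<Longrightarrow> fst (S j) \<in> X"
begin

lemma sample_combination_mem: "sample_combination n S a \<in> H"
  and ip_sample_combination:
    "f \<in> H \<Longrightarrow> ip f (sample_combination n S a) = (\<Sum>j<n. a $ j * f (fst (S j)))"
  using section_combination[of n "\<lambda>j. fst (S j)" "\<lambda>j. a $ j"] points
  by (auto simp: sample_combination_def)

lemma sample_combination_eval:
  assumes "a \<in> carrier_vec n" "i < n"
  shows "sample_combination n S a (fst (S i)) = (kernel_mat K n S *\<^sub>v a) $ i"
  using assms points
  by (auto simp: sample_combination_def kernel_section_def kernel_mat_def scalar_prod_def
      lessThan_atLeast0 kernel_sym mult.commute intro!: sum.cong)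

lemma sample_combination_norm:
  assumes "a \<in> carrier_vec n"
  shows "ip (sample_combination n S a) (sample_combination n S a) =
    scalar_prod a (kernel_mat K n S *\<^sub>v a)"
  unfolding ip_sample_combination[OF sample_combination_mem]
  using sample_combination_eval[OF assms]
  by (simp add: scalar_prod_def lessThan_atLeast0 kernel_mat_def del: index_mult_mat_vec)

text \<open>The quadratic form at \<open>a\<close> is the squared norm of
  \<open>sample_combination n S a\<close>.\<close>

lemma psd_kernel_mat: "psd_mat (kernel_mat K n S)"
proof -
  have "transpose_mat (kernel_mat K n S) = kernel_mat K n S"
    using points by (intro eq_matI) (auto simp: kernel_mat_def kernel_sym)
  moreover have "0 \<le> scalar_prod a (kernel_mat K n S *\<^sub>v a)" if "a \<in> carrier_vec n" for a
    using sample_combination_norm[OF that] ip_nonneg[OF sample_combination_mem] by metis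
  ultimately show ?thesis
    by (simp add: psd_mat_def square_mat.simps kernel_mat_def)
qed

text \<open>The residual \<open>r\<close> of the labels satisfies \<open>A r = 0\<close>, so the combination of sections with
  coefficients \<open>r\<close> is the zero function; pairing it with an interpolant shows that \<open>r\<close> is orthogonal to the labels.\<close>

lemma kernel_mat_pinv_label:
  assumes f: "f \<in> interpolants H {..<n} S"
  shows "kernel_mat K n S *\<^sub>v (pinv (kernel_mat K n S) *\<^sub>v label_vec n S) = label_vec n S"
proof -
  define A where "A = kernel_mat K n S"
  define P where "P = pinv A"
  define y where "y = label_vec n S"
  have A: "A \<in> carrier_mat n n" "psd_mat A" by (simp_all add: A_def psd_kernel_mat)
  have sym: "transpose_mat A = A" using A(2) by (simp add: psd_mat_def)
  have P: "P \<in> carrier_mat n n" "A * P * A = A" "transpose_mat (A * P) = A * P"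
    using is_pinv_pinv[OF A] A by (auto simp: is_pinv_def P_def)
  have y: "y \<in> carrier_vec n" by (simp add: y_def label_vec_def)
  define p where "p = P *\<^sub>v y"
  have p: "p \<in> carrier_vec n" unfolding p_def by (rule mult_mat_vec_carrier[OF P(1) y])
  have Ap: "A *\<^sub>v p \<in> carrier_vec n" by (rule mult_mat_vec_carrier[OF A(1) p])
  define r where "r = y - A *\<^sub>v p"
  have r: "r \<in> carrier_vec n" using y Ap by (simp add: r_def)
  have AP: "A * P \<in> carrier_mat n n" by (rule mult_carrier_mat[OF A(1) P(1)])
  \<comment> \<open>Transpose \<open>A * P * A = A\<close>, both \<open>A\<close> and
    \<open>A * P\<close> being symmetric.\<close>
  have "A * (A * P) = A"
    using transpose_mult[OF AP A(1)] by (simp only: P sym)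
  then have "A *\<^sub>v (A *\<^sub>v p) = A *\<^sub>v y"
    unfolding p_def
    using assoc_mult_mat_vec[OF A(1) AP y] assoc_mult_mat_vec[OF A(1) P(1) y]
    by (simp del: assoc_mult_mat_vec)
  moreover have Ay: "A *\<^sub>v y \<in> carrier_vec n" by (rule mult_mat_vec_carrier[OF A(1) y])
  ultimately have Ar: "A *\<^sub>v r = 0\<^sub>v n"
    unfolding r_def mult_minus_distrib_mat_vec[OF A(1) y Ap] by simp
  then have "ip (sample_combination n S r) (sample_combination n S r) = 0"
    unfolding sample_combination_norm[OF r] A_def[symmetric] using r by simp
  then have "sample_combination n S r = (\<lambda>_. 0)"
    using ip_definite sample_combination_mem by blast
  moreover have "f \<in> H" using f by (simp add: interpolants_def)
  ultimately have "(\<Sum>j<n. r $ j * f (fst (S j))) = 0"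
    using ip_sample_combination[of f r] ip_zero_right by simp
  then have ry: "scalar_prod r y = 0"
    using f by (simp add: scalar_prod_def y_def label_vec_def interpolants_def lessThan_atLeast0)
  \<comment> \<open>By symmetry and \<open>A *\<^sub>v r = 0\<^sub>v n\<close>; so \<open>r\<close>
    is orthogonal to both of its terms, hence to itself.\<close>
  have "scalar_prod r (A *\<^sub>v p) = 0"
    using transpose_vec_mult_scalar[OF A(1) p r] p by (simp add: sym Ar)
  moreover have "scalar_prod r r = scalar_prod r y - scalar_prod r (A *\<^sub>v p)"
    by (subst (2) r_def) (rule scalar_prod_minus_distrib[OF r y Ap])
  ultimately have r0: "r = 0\<^sub>v n" using ry scalar_prod_self_eq_0[OF r] by simp
  have "A *\<^sub>v p = y"
  proof (rule eq_vecI)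
    fix i assume "i < dim_vec y"
    then have i: "i < n" using y by simp
    then have "(y - A *\<^sub>v p) $ i = 0" using r0 by (simp add: r_def)
    then show "(A *\<^sub>v p) $ i = y $ i"
      using i index_minus_vec(1)[of i "A *\<^sub>v p" y] A(1)
      by (simp del: index_mult_mat_vec)
  qed (use y Ap A(1) in auto)
  then show ?thesis by (simp add: A_def p_def P_def y_def)
qed

lemma leave_one_out_error_le:
  assumes "interpolants H {..<n} S \<noteq> {}" "i < n" "set js = {..<n} - {i}"
    and \<kappa>: "K (fst (S i)) (fst (S i)) \<le> \<kappa>"
  shows "(snd (S i) - successive_interpolant (kernel_section X K) (map S js) (fst (S i)))\<^sup>2 \<le>
    \<kappa> * ((op_norm (psd_sqrt (kernel_mat K n S)))\<^sup>2 * (op_norm (pinv (kernel_mat K n S)))\<^sup>2 *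
      (cond_num (kernel_mat K n S))\<^sup>2 * (vnorm (label_vec n S))\<^sup>2)"
proof -
  define A y where "A = kernel_mat K n S" and "y = label_vec n S"
  define g where "g = successive_interpolant (kernel_section X K) (map S js)"
  define p where "p = pinv A *\<^sub>v y"
  define h where "h = sample_combination n S p"
  have A: "A \<in> carrier_mat n n" "psd_mat A" by (simp_all add: A_def psd_kernel_mat)
  have y: "y \<in> carrier_vec n" by (simp add: y_def label_vec_def)
  have "pinv A \<in> carrier_mat n n" using is_pinv_pinv[OF A] A by (auto simp: is_pinv_def)
  then have p: "p \<in> carrier_vec n" unfolding p_def by (rule mult_mat_vec_carrier[OF _ y])
  have Ap: "A *\<^sub>v p = y"
    using assms(1) kernel_mat_pinv_label by (auto simp: A_def p_def y_def)
  have h_H: "h \<in> H" by (simp add: h_def sample_combination_mem)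
  have h_eval: "h (fst (S j)) = snd (S j)" if "j < n" for j
    using sample_combination_eval[OF p that] Ap that
    by (simp add: h_def A_def y_def label_vec_def)
  have h_norm: "ip h h = scalar_prod y p"
    unfolding h_def sample_combination_norm[OF p] A_def[symmetric] Ap
    by (rule comm_scalar_prod[OF p y])
  \<comment> \<open>\<open>h\<close> also interpolates the reduced sample, so Pythagoras compares it
    with \<open>g\<close>; at the removed point \<open>h\<close> takes the label, and
    \<open>e\<close> is the leave-one-out residual there.\<close>
  have "h \<in> interpolants H ({..<n} - {i}) S" using h_H h_eval by (simp add: interpolants_def)
  note g = successive_interpolant_interpolants[of _ "{..<n} - {i}" S js, OF this _ assms(3), folded g_def, OF points]
  define e where "e = (\<lambda>x. h x - g x)"
  have gH: "g \<in> H" using g(1) by (auto simp: interpolants_def)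
  have eH: "e \<in> H" unfolding e_def by (rule diff_mem[OF h_H gH])
  have "ip e e \<le> ip h h"
    using g(2) ip_nonneg[OF gH] by (auto simp: e_def)
  have "(snd (S i) - g (fst (S i)))\<^sup>2 = (e (fst (S i)))\<^sup>2"
    using h_eval[OF assms(2)] by (simp add: e_def)
  also have "\<dots> \<le> K (fst (S i)) (fst (S i)) * ip e e"
    by (rule eval_bound[OF eH points[OF assms(2)]])
  also have "\<dots> \<le> \<kappa> * ip e e" by (rule mult_right_mono[OF \<kappa> ip_nonneg[OF eH]])
  also have "\<dots> \<le> \<kappa> * ip h h"
  proof (rule mult_left_mono[OF \<open>ip e e \<le> ip h h\<close>])
    have "0 \<le> K (fst (S i)) (fst (S i))"
      using ip_nonneg[OF section_mem] kernel_section_ip points[OF assms(2)] by metis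
    then show "0 \<le> \<kappa>" using \<kappa> by linarith
  qed
  also have "\<dots> \<le> \<kappa> * ((op_norm (psd_sqrt A))\<^sup>2 * (op_norm (pinv A))\<^sup>2 * (cond_num A)\<^sup>2 * (vnorm y)\<^sup>2)"
  proof (rule mult_left_mono)
    show "ip h h \<le> (op_norm (psd_sqrt A))\<^sup>2 * (op_norm (pinv A))\<^sup>2 * (cond_num A)\<^sup>2 * (vnorm y)\<^sup>2"
      unfolding h_norm p_def
      by (rule pinv_quadratic_le[OF A y]) (use Ap in \<open>simp add: p_def\<close>)
    have "0 \<le> K (fst (S i)) (fst (S i))"
      using ip_nonneg[OF section_mem] kernel_section_ip points[OF assms(2)] by metis
    then show "0 \<le> \<kappa>" using \<kappa> by linarith
  qed
  finally show ?thesis by (simp add: g_def A_def y_def)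
qed

end

end

section \<open>Expected risk\<close>

text \<open>The Schur complement depends on the sample, so the kernel is a family indexed by
  \<open>\<omega>\<close> and the induction generalizes over it. Measurability along random points
  is inherited by the complement.\<close>

lemma measurable_successive_interpolant:
  assumes "\<And>p q. p \<in> measurable M N \<Longrightarrow> q \<in> measurable M N \<Longrightarrow>
      (\<lambda>\<omega>. k \<omega> (p \<omega>) (q \<omega>)) \<in> borel_measurable M"
    and "\<And>p t. (p, t) \<in> set zs \<Longrightarrow> p \<in> measurable M N"
    and "\<And>p t. (p, t) \<in> set zs \<Longrightarrow> t \<in> borel_measurable M"
    and "q \<in> measurable M N"
  shows "(\<lambda>\<omega>. successive_interpolant (k \<omega>) (map (\<lambda>(p, t). (p \<omega>, t \<omega>)) zs) (q \<omega>))
    \<in> borel_measurable M"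
  using assms(1-3)
proof (induction "length zs" arbitrary: zs k)
  case 0
  then show ?case by simp
next
  case (Suc m)
  obtain a y zs0 where zs: "zs = (a, y) # zs0" using Suc.hyps(2) by (cases zs) auto
  define c where "c = (\<lambda>\<omega>. y \<omega> / k \<omega> (a \<omega>) (a \<omega>))"
  define k' where "k' = (\<lambda>\<omega> s t. k \<omega> s t - k \<omega> s (a \<omega>) / k \<omega> (a \<omega>) (a \<omega>) * k \<omega> (a \<omega>) t)"
  define zs' where "zs' = map (\<lambda>(p, t). (p, \<lambda>\<omega>. t \<omega> - c \<omega> * k \<omega> (a \<omega>) (p \<omega>))) zs0"
  note k = Suc.prems(1)
  have a: "a \<in> measurable M N" and y: "y \<in> borel_measurable M"
    using Suc.prems(2,3) by (auto simp: zs)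
  have c: "c \<in> borel_measurable M"
    unfolding c_def by (intro borel_measurable_divide y k a)
  have "(\<lambda>\<omega>. successive_interpolant (k' \<omega>) (map (\<lambda>(p, t). (p \<omega>, t \<omega>)) zs') (q \<omega>))
      \<in> borel_measurable M"
  proof (rule Suc.hyps(1))
    show "m = length zs'" using Suc.hyps(2) by (simp add: zs zs'_def)
    show "(\<lambda>\<omega>. k' \<omega> (p \<omega>) (q \<omega>)) \<in> borel_measurable M"
      if "p \<in> measurable M N" "q \<in> measurable M N" for p q
      unfolding k'_def
      by (intro borel_measurable_diff borel_measurable_times borel_measurable_divide k a that)
    show "p \<in> measurable M N" if "(p, t) \<in> set zs'" for p t
      using that Suc.prems(2) by (auto simp: zs'_def zs)
    show "t \<in> borel_measurable M" if pt: "(p, t) \<in> set zs'" for p t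
    proof -
      obtain t0 where t0: "(p, t0) \<in> set zs0" "t = (\<lambda>\<omega>. t0 \<omega> - c \<omega> * k \<omega> (a \<omega>) (p \<omega>))"
        using pt by (auto simp: zs'_def)
      then have "p \<in> measurable M N" "t0 \<in> borel_measurable M"
        using Suc.prems(2,3) by (auto simp: zs)
      then show ?thesis
        unfolding t0(2) by (intro borel_measurable_diff borel_measurable_times k a c)
    qed
  qed
  then have "(\<lambda>\<omega>. c \<omega> * k \<omega> (a \<omega>) (q \<omega>) +
      successive_interpolant (k' \<omega>) (map (\<lambda>(p, t). (p \<omega>, t \<omega>)) zs') (q \<omega>)) \<in> borel_measurable M"
    by (intro borel_measurable_add borel_measurable_times k a c assms(4))
  moreover have "map (\<lambda>(p, t). (p \<omega>, t \<omega>)) zs' =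
      map (\<lambda>(b, t). (b, t - c \<omega> * k \<omega> (a \<omega>) b)) (map (\<lambda>(p, t). (p \<omega>, t \<omega>)) zs0)" for \<omega>
    by (auto simp: zs'_def)
  ultimately show ?case by (simp add: zs c_def k'_def)
qed

text \<open>\<open>\<phi> S\<close> ignores coordinate \<open>i\<close>, so a fresh point
  \<open>z\<close> and the removed example \<open>S i\<close> are both independent of it with law
  \<open>\<mu>\<close>.\<close>

lemma nn_integral_leave_one_out:
  fixes \<phi> :: "(nat \<Rightarrow> 'a \<times> real) \<Rightarrow> 'a \<times> real \<Rightarrow> ennreal"
  assumes "prob_space \<mu>" "i < n"
    and meas: "case_prod \<phi> \<in> borel_measurable (sample_measure \<mu> n \<Otimes>\<^sub>M \<mu>)"
    and indep: "\<And>S y z. \<phi> (S(i := y)) z = \<phi> S z"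
  shows "(\<integral>\<^sup>+ S. \<integral>\<^sup>+ z. \<phi> S z \<partial>\<mu> \<partial>sample_measure \<mu> n) = (\<integral>\<^sup>+ S. \<phi> S (S i) \<partial>sample_measure \<mu> n)"
proof -
  interpret prob_space \<mu> by fact
  interpret product_sigma_finite "\<lambda>_ :: nat. \<mu>" by standard
  define J where "J = {..<n} - {i}"
  have J: "finite J" "i \<notin> J" "insert i J = {..<n}" using assms(2) by (auto simp: J_def)
  have sm: "sample_measure \<mu> n = Pi\<^sub>M (insert i J) (\<lambda>_. \<mu>)" by (simp add: sample_measure_def J)
  have 1: "(\<lambda>S. \<integral>\<^sup>+ z. \<phi> S z \<partial>\<mu>) \<in> borel_measurable (Pi\<^sub>M (insert i J) (\<lambda>_. \<mu>))"
    using meas unfolding sm by (rule borel_measurable_nn_integral)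
  have "(\<lambda>S. (S, S i)) \<in> measurable (Pi\<^sub>M (insert i J) (\<lambda>_. \<mu>)) (Pi\<^sub>M (insert i J) (\<lambda>_. \<mu>) \<Otimes>\<^sub>M \<mu>)"
    by (intro measurable_Pair measurable_ident_sets measurable_component_singleton) auto
  from measurable_compose[OF this meas[unfolded sm]]
  have 2: "(\<lambda>S. \<phi> S (S i)) \<in> borel_measurable (Pi\<^sub>M (insert i J) (\<lambda>_. \<mu>))" by simp
  \<comment> \<open>Once coordinate \<open>i\<close> is split off, the left side integrates a
    constant over it, with total mass 1.\<close>
  have "\<phi> (S(i := y)) = \<phi> S" for S y by (rule ext) (rule indep)
  then show ?thesis
    unfolding sm product_nn_integral_insert[OF J(1,2) 1] product_nn_integral_insert[OF J(1,2) 2]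
    by (simp add: emeasure_space_1)
qed

text \<open>\<open>g\<close> need not be measurable, so \<open>nn_integral_cmult\<close> does not apply to it.\<close>

lemma nn_integral_le_cmult:
  assumes f: "f \<in> borel_measurable M" and "0 < c"
    and le: "AE x in M. f x \<le> ennreal c * g x"
  shows "integral\<^sup>N M f \<le> ennreal c * integral\<^sup>N M g"
proof -
  have inv: "ennreal c * (ennreal (1 / c) * a) = a" "ennreal (1 / c) * (ennreal c * a) = a" for a
    using assms(2) by (simp_all add: mult.assoc[symmetric] ennreal_mult[symmetric])
  \<comment> \<open>The constant is pulled out of the integral of the measurable \<open>f\<close>;
    only monotonicity is applied to \<open>g\<close>.\<close>
  have "integral\<^sup>N M f = (\<integral>\<^sup>+ x. ennreal c * (ennreal (1 / c) * f x) \<partial>M)" by (simp add: inv)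
  also have "\<dots> = ennreal c * (\<integral>\<^sup>+ x. ennreal (1 / c) * f x \<partial>M)"
    using f by (intro nn_integral_cmult) auto
  also have "\<dots> \<le> ennreal c * integral\<^sup>N M g"
  proof (intro mult_left_mono nn_integral_mono_AE)
    show "AE x in M. ennreal (1 / c) * f x \<le> g x"
      using le
    proof eventually_elim
      case (elim x)
      then have "ennreal (1 / c) * f x \<le> ennreal (1 / c) * (ennreal c * g x)"
        by (rule mult_left_mono) simp
      then show ?case by (simp add: inv)
    qed
  qed simp
  finally show ?thesis .
qed

lemma excess_risk_le:
  assumes \<kappa>: "0 < \<kappa>" and "i < n" "prob_space \<mu>"
    and sets: "sets \<mu> = sets (Rd d \<Otimes>\<^sub>M borel)"
    and K: "case_prod K \<in> borel_measurable (Rd d \<Otimes>\<^sub>M Rd d)"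
    and rkhs: "rkhs (space (Rd d)) K H ip"
    and bound: "ae_bounded_kernel \<mu> K \<kappa>"
    and interp: "AE S in sample_measure \<mu> n. interpolants H {..<n} S \<noteq> {}"
  shows "expected_excess_risk \<mu> H ip n i \<le> ennreal \<kappa> * beta2 \<mu> K n"
proof -
  interpret rkhs "space (Rd d)" K H ip by fact
  interpret prob_space \<mu> by fact
  define X where "X = space (Rd d)"
  define js where "js = filter (\<lambda>j. j \<noteq> i) [0..<n]"
  have js: "set js = {..<n} - {i}" by (auto simp: js_def)
  define g where "g = (\<lambda>S. successive_interpolant (kernel_section X K) (map S js))"
  define \<phi> where "\<phi> = (\<lambda>S z. ennreal ((snd z - g S (fst z))\<^sup>2))"
  have space_\<mu>: "space \<mu> = X \<times> UNIV"
    using sets_eq_imp_space_eq[OF sets] by (simp add: space_pair_measure X_def)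
  have points: "fst (S j) \<in> X" if "S \<in> space (sample_measure \<mu> n)" "j < n" for S j
    using that by (auto simp: sample_measure_def space_PiM PiE_iff space_\<mu> mem_Times_iff)
  have fst_meas: "fst \<in> measurable \<mu> (Rd d)" and snd_meas: "snd \<in> borel_measurable \<mu>"
    by (simp_all add: measurable_cong_sets[OF sets refl])
  \<comment> \<open>The joint distribution of the sample and an independent test point.\<close>
  define N where "N = sample_measure \<mu> n \<Otimes>\<^sub>M \<mu>"
  have sample: "(\<lambda>\<omega>. fst \<omega> j) \<in> measurable N \<mu>" if "j < n" for j
    unfolding N_def sample_measure_def
    by (rule measurable_compose[OF measurable_fst measurable_component_singleton]) (use that in simp)
  have k_meas: "(\<lambda>\<omega>. kernel_section X K (p \<omega>) (q \<omega>)) \<in> borel_measurable N"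
    if pq: "p \<in> measurable N (Rd d)" "q \<in> measurable N (Rd d)" for p q
  proof -
    have "(\<lambda>\<omega>. case_prod K (p \<omega>, q \<omega>)) \<in> borel_measurable N"
      by (rule measurable_compose[OF measurable_Pair[OF pq] K])
    moreover have "kernel_section X K (p \<omega>) (q \<omega>) = case_prod K (p \<omega>, q \<omega>)" if "\<omega> \<in> space N" for \<omega>
      using measurable_space[OF pq(2) that] by (simp add: kernel_section_def X_def)
    ultimately show ?thesis by (simp cong: measurable_cong)
  qed
  \<comment> \<open>The retained examples as random variables on \<open>N\<close>; evaluated at
    \<open>\<omega>\<close> they are the list defining \<open>g (fst \<omega>)\<close>.\<close>
  define zs where "zs = map (\<lambda>j.
    (\<lambda>\<omega> :: (nat \<Rightarrow> (nat \<Rightarrow> real) \<times> real) \<times> (nat \<Rightarrow> real) \<times> real. fst (fst \<omega> j),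
     \<lambda>\<omega> :: (nat \<Rightarrow> (nat \<Rightarrow> real) \<times> real) \<times> (nat \<Rightarrow> real) \<times> real. snd (fst \<omega> j))) js"
  have "(\<lambda>\<omega>. successive_interpolant (kernel_section X K) (map (\<lambda>(p, t). (p \<omega>, t \<omega>)) zs)
      (fst (snd \<omega>))) \<in> borel_measurable N"
  proof (rule measurable_successive_interpolant[where N = "Rd d" and k = "\<lambda>_. kernel_section X K"])
    show "p \<in> measurable N (Rd d)" if "(p, t) \<in> set zs" for p t
      using that js sample measurable_compose[OF sample fst_meas] by (auto simp: zs_def)
    show "t \<in> borel_measurable N" if "(p, t) \<in> set zs" for p t
      using that js sample measurable_compose[OF sample snd_meas] by (auto simp: zs_def)
    show "(\<lambda>\<omega>. fst (snd \<omega>)) \<in> measurable N (Rd d)"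
      unfolding N_def by (rule measurable_compose[OF measurable_snd fst_meas])
  qed (rule k_meas)
  moreover have "map (\<lambda>(p, t). (p \<omega>, t \<omega>)) zs = map (fst \<omega>) js" for \<omega>
    by (simp add: zs_def)
  ultimately have g_meas: "(\<lambda>\<omega>. g (fst \<omega>) (fst (snd \<omega>))) \<in> borel_measurable N"
    by (simp add: g_def)
  have "(\<lambda>\<omega>. snd (snd \<omega>)) \<in> borel_measurable N"
    unfolding N_def by (rule measurable_compose[OF measurable_snd snd_meas])
  with g_meas have \<phi>_meas: "case_prod \<phi> \<in> borel_measurable N"
    unfolding \<phi>_def case_prod_beta by measurable
  have \<phi>_indep: "\<phi> (S(i := y)) z = \<phi> S z" for S y z
  proof -
    have "map (S(i := y)) js = map S js" using js by (intro map_cong) auto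
    then show ?thesis by (simp only: \<phi>_def g_def)
  qed
  \<comment> \<open>The bound will be applied at equal points, to the diagonal value at the removed
    input.\<close>
  obtain A where A: "AE z in \<mu>. fst z \<in> A" "\<And>x x'. x \<in> A \<Longrightarrow> x' \<in> A \<Longrightarrow> K x x' \<le> \<kappa>"
    using bound unfolding ae_bounded_kernel_def by blast
  have AE_A: "AE S in sample_measure \<mu> n. fst (S i) \<in> A"
    unfolding sample_measure_def
    by (rule AE_PiM_component[of "{..<n}" "\<lambda>_. \<mu>" i "\<lambda>z. fst z \<in> A"]) (use assms A in auto)
  \<comment> \<open>Subtraction in \<open>ennreal\<close> never increases the risk. An interpolant
    of the full sample also interpolates the reduced one, so almost surely the minimizer exists and
    equals \<open>g S\<close>.\<close>
  have "expected_excess_risk \<mu> H ip n i \<le> (\<integral>\<^sup>+ S. \<integral>\<^sup>+ z. \<phi> S z \<partial>\<mu> \<partial>sample_measure \<mu> n)"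
    unfolding expected_excess_risk_def
  proof (rule nn_integral_mono_AE)
    show "AE S in sample_measure \<mu> n. risk \<mu> (min_norm_interpolant H ip ({..<n} - {i}) S)
        - (INF f\<in>H. risk \<mu> f) \<le> (\<integral>\<^sup>+ z. \<phi> S z \<partial>\<mu>)"
      using interp AE_space
    proof eventually_elim
      case (elim S)
      then have "interpolants H ({..<n} - {i}) S \<noteq> {}" by (auto simp: interpolants_def)
      then have "min_norm_interpolant H ip ({..<n} - {i}) S = g S"
        using min_norm_interpolant_eq[OF _ _ js] points[OF elim(2)] by (simp add: g_def X_def)
      then show ?case by (simp add: risk_def \<phi>_def)
    qed
  qed
  also have "\<dots> = (\<integral>\<^sup>+ S. \<phi> S (S i) \<partial>sample_measure \<mu> n)"
    by (rule nn_integral_leave_one_out[OF assms(3,2) \<phi>_meas[unfolded N_def] \<phi>_indep])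
  also have "\<dots> \<le> ennreal \<kappa> * beta2 \<mu> K n"
    unfolding beta2_def
  proof (rule nn_integral_le_cmult[OF _ \<kappa>])
    have "(\<lambda>S. (S, S i)) \<in> measurable (sample_measure \<mu> n) N"
      unfolding N_def sample_measure_def
      by (intro measurable_Pair measurable_ident_sets measurable_component_singleton)
        (use assms(2) in auto)
    from measurable_compose[OF this \<phi>_meas]
    show "(\<lambda>S. \<phi> S (S i)) \<in> borel_measurable (sample_measure \<mu> n)" by simp
    show "AE S in sample_measure \<mu> n. \<phi> S (S i) \<le> ennreal \<kappa> *
        ennreal ((op_norm (psd_sqrt (kernel_mat K n S)))\<^sup>2 * (op_norm (pinv (kernel_mat K n S)))\<^sup>2 *
          (cond_num (kernel_mat K n S))\<^sup>2 * (vnorm (label_vec n S))\<^sup>2)"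
      using interp AE_space AE_A
    proof eventually_elim
      case (elim S)
      show ?case
        unfolding \<phi>_def g_def X_def ennreal_mult'[OF less_imp_le[OF \<kappa>], symmetric]
        using leave_one_out_error_le[OF _ elim(1) assms(2) js A(2)[OF elim(3) elim(3)]]
          points[OF elim(2)]
        by (intro ennreal_leI) (simp add: X_def)
    qed
  qed
  finally show ?thesis .
qed

theorem corollary8:
  fixes \<kappa> M :: real
  assumes "\<kappa> > 0" and "M > 0"
  shows "\<exists>C1 C2 :: real. 0 \<le> C1 \<and> 0 \<le> C2 \<and>
    (\<forall>(d :: nat) (n :: nat) (i :: nat) (\<mu> :: ((nat \<Rightarrow> real) \<times> real) measure)
       (K :: (nat \<Rightarrow> real) \<Rightarrow> (nat \<Rightarrow> real) \<Rightarrow> real)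
       (H :: ((nat \<Rightarrow> real) \<Rightarrow> real) set)
       (ip :: ((nat \<Rightarrow> real) \<Rightarrow> real) \<Rightarrow> ((nat \<Rightarrow> real) \<Rightarrow> real) \<Rightarrow> real).
       i < n \<longrightarrow>
       prob_space \<mu> \<longrightarrow>
       sets \<mu> = sets (Rd d \<Otimes>\<^sub>M borel) \<longrightarrow>
       pd_kernel (space (Rd d)) K \<longrightarrow>
       case_prod K \<in> borel_measurable (Rd d \<Otimes>\<^sub>M Rd d) \<longrightarrow>
       rkhs (space (Rd d)) K H ip \<longrightarrow>
       ae_bounded_kernel \<mu> K \<kappa> \<longrightarrow>
       (AE z in \<mu>. \<bar>snd z\<bar> \<le> M) \<longrightarrow>
       (AE S in sample_measure \<mu> n. interpolants H {..<n} S \<noteq> {}) \<longrightarrow>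
       expected_excess_risk \<mu> H ip n i
         \<le> ennreal C1 * beta1 \<mu> K n + ennreal C2 * beta2 \<mu> K n)"
proof (rule exI[of _ 0], rule exI[of _ \<kappa>], intro conjI allI impI)
  fix d n i :: nat and \<mu> :: "((nat \<Rightarrow> real) \<times> real) measure"
    and K :: "(nat \<Rightarrow> real) \<Rightarrow> (nat \<Rightarrow> real) \<Rightarrow> real"
    and H :: "((nat \<Rightarrow> real) \<Rightarrow> real) set"
    and ip :: "((nat \<Rightarrow> real) \<Rightarrow> real) \<Rightarrow> ((nat \<Rightarrow> real) \<Rightarrow> real) \<Rightarrow> real"
  assume "i < n" "prob_space \<mu>" "sets \<mu> = sets (Rd d \<Otimes>\<^sub>M borel)"
    "case_prod K \<in> borel_measurable (Rd d \<Otimes>\<^sub>M Rd d)" "rkhs (space (Rd d)) K H ip"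
    "ae_bounded_kernel \<mu> K \<kappa>" "AE S in sample_measure \<mu> n. interpolants H {..<n} S \<noteq> {}"
  from excess_risk_le[OF assms(1) this]
  show "expected_excess_risk \<mu> H ip n i \<le> ennreal 0 * beta1 \<mu> K n + ennreal \<kappa> * beta2 \<mu> K n"
    by simp
qed (use assms in auto)

end
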